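(* Let $A, H\in\mathbb{R}^{n\times n}$ with $H$ real, invertible and Hermitian (that is, $H=H^\top$), and let $A$ be $H$-selfadjoint. Let $$J=J(\lambda_1)\oplus\cdots\oplus J(\lambda_\alpha)\oplus\widehat{J}(\lambda_{\alpha+1})\oplus\cdots\oplus\widehat{J}(\lambda_\beta)$$ be the Jordan form of $A$, where $\lambda_1,\ldots,\lambda_\alpha\in\mathbb{R}$, $\lambda_{\alpha+1},\ldots,\lambda_\beta\in\mathbb{C}\setminus\mathbb{R}$. Then there exist signs $\epsilon_1,\ldots,\epsilon_\alpha\in\{1,-1\}$ and an invertible matrix $N\in\mathbb{C}^{n\times n}$ such that, with the corresponding sip matrix $P=P_1\oplus\cdots\oplus P_\beta$, $$N^{-1}AN=J\quad\text{and}\quad N^*HN=P$$ (i.e. the columns of $N$ form a flipped orthogonal Jordan basis of $(A,H)$), and simultaneously the columns of $N$ are $i$-conjugate symmetric: partitioning $N=[N_1\,|\,\cdots\,|\,N_\beta]$ conformably with the direct sum decomposition of $J$, for every $k=\alpha+1,\ldots,\beta$ one has $$N_k=[\,Q_k\,|\,i\,\overline{Q_k}\,]$$ for some complex matrix $Q_k$, whose number of columns is the size of the block $J(\lambda_k)$.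
   Context: $A$ is called $H$-selfadjoint (for an invertible Hermitian matrix $H$) if $A=H^{-1}A^*H$, where $^*$ denotes conjugate transpose; $\overline{Q}$ denotes the entrywise complex conjugate. $J(\lambda_k)$ denotes a single upper-triangular Jordan block with eigenvalue $\lambda_k$ (ones on the superdiagonal), of some size $p_k$; the $\lambda_k$ need not be distinct. For non-real $\lambda_k$, $\widehat{J}(\lambda_k)=J(\lambda_k)\oplus J(\overline{\lambda_k})$, with both blocks of the same size $p_k$. (Since $A$ is real, its Jordan form can be arranged in this way.) The sip matrix of size $m$ is the $m\times m$ matrix $\widetilde{I}$ with ones on the antidiagonal and zeros elsewhere. The matrix $P=P_1\oplus\cdots\oplus P_\beta$ has $P_k=\epsilon_k\widetilde{I}$ of size $p_k$ (the same size as $J(\lambda_k)$) for $k=1,\ldots,\alpha$, and $P_k=\widetilde{I}$ of size $2p_k$ (the same size as $\widehat{J}(\lambda_k)$) for $k=\alpha+1,\ldots,\beta$. *)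

theory Defs
  imports "Jordan_Normal_Form.Jordan_Normal_Form_Existence"
begin

text \<open>
  Over the reals \<open>conjugate\<close> is the identity, so there \<open>mat_adjoint\<close> is the transpose.
\<close>
definition H_selfadjoint :: "'a :: conjugatable_field mat \<Rightarrow> 'a mat \<Rightarrow> bool" where
  "H_selfadjoint H A \<longleftrightarrow>
     (\<exists>Hinv. inverts_mat H Hinv \<and> inverts_mat Hinv H \<and> A = Hinv * mat_adjoint A * H)"

text \<open>
  Blocks \<open>1, \<dots>, \<alpha>\<close> belong to real eigenvalues; they are followed for
  \<open>k = \<alpha> + 1, \<dots>, \<beta>\<close> by the pairs \<open>J(lam k) \<oplus> J(cnj (lam k))\<close>, both of size \<open>p k\<close>. The associated
  direct sum of blocks is the library's \<open>jordan_matrix\<close> of this list.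
\<close>
definition paired_jordan_blocks ::
  "nat \<Rightarrow> nat \<Rightarrow> (nat \<Rightarrow> nat) \<Rightarrow> (nat \<Rightarrow> complex) \<Rightarrow> (nat \<times> complex) list" where
  "paired_jordan_blocks \<alpha> \<beta> p lam =
     map (\<lambda>k. (p k, lam k)) [1..<Suc \<alpha>] @
     concat (map (\<lambda>k. [(p k, lam k), (p k, cnj (lam k))]) [Suc \<alpha>..<Suc \<beta>])"

definition sip_mat :: "nat \<Rightarrow> 'a :: {zero,one} mat" where
  "sip_mat m = mat m m (\<lambda>(i, j). if i + j + 1 = m then 1 else 0)"

definition sip_block_sum ::
  "nat \<Rightarrow> nat \<Rightarrow> (nat \<Rightarrow> nat) \<Rightarrow> (nat \<Rightarrow> complex) \<Rightarrow> complex mat" where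
  "sip_block_sum \<alpha> \<beta> p \<epsilon> = diag_block_mat
     (map (\<lambda>k. \<epsilon> k \<cdot>\<^sub>m sip_mat (p k)) [1..<Suc \<alpha>] @
      map (\<lambda>k. sip_mat (2 * p k)) [Suc \<alpha>..<Suc \<beta>])"

text \<open>The partitioned matrix \<open>[M\<^sub>1 | \<dots> | M\<^sub>r]\<close>, for matrices with \<open>n\<close> rows each.\<close>
definition hconcat_mat :: "nat \<Rightarrow> 'a mat list \<Rightarrow> 'a mat" where
  "hconcat_mat n Ms = mat_of_cols n (concat (map cols Ms))"

definition i_conjugate_symmetric ::
  "nat \<Rightarrow> nat \<Rightarrow> nat \<Rightarrow> (nat \<Rightarrow> nat) \<Rightarrow> complex mat \<Rightarrow> bool" where
  "i_conjugate_symmetric n \<alpha> \<beta> p N \<longleftrightarrow>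
     (\<exists>Nb. N = hconcat_mat n (map Nb [1..<Suc \<beta>]) \<and>
           (\<forall>k\<in>{1..\<alpha>}. Nb k \<in> carrier_mat n (p k)) \<and>
           (\<forall>k\<in>{\<alpha>+1..\<beta>}. Nb k \<in> carrier_mat n (2 * p k) \<and>
              (\<exists>Q \<in> carrier_mat n (p k).
                 Nb k = hconcat_mat n [Q, \<i> \<cdot>\<^sub>m map_mat cnj Q])))"

end

theory Submission
  imports Defs
begin

text \<open>
  A real pair \<open>(A, H)\<close> carries two forms for which \<open>A\<close> is selfadjoint: the hermitian form
  \<open>x\<^sup>* H y\<close> and the bilinear form \<open>x\<^sup>T H y\<close>. Both are of the shape \<open>\<sigma>(x)\<^sup>T H y\<close> for an involutive field
  automorphism \<open>\<sigma>\<close> (conjugation or the identity), and every eigenvalue \<open>l\<close> is fixed by one of the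
  two: a real \<open>l\<close> by conjugation, a nonreal \<open>l\<close> by the identity. When \<open>\<sigma> l = l\<close>, the nilpotent part
  \<open>A - l\<close> is selfadjoint too, the generalized eigenspace of \<open>l\<close> is orthogonal to all others
  (\<open>generalized_eigenvectors_orthogonal\<close>), and hence the form is nondegenerate on it
  (\<open>jordan_basis_nondegenerate\<close>).

  Selfadjointness of \<open>A - l\<close> means that the products between two Jordan chains depend only on the
  sum of the two positions. A Lagrange reduction can therefore be carried out on whole chains:
  some chain of maximal length can be chosen whose two ends have nonzero product (\<open>exists_pivot\<close>),
  the other chains are made orthogonal to it (\<open>orthogonalize_against_chain\<close>), and one continues with
  the rest. The reduction starts from the given Jordan basis and keeps the length of every chain,
  so that the prescribed order of the blocks survives. Finally each chain is normalized separately
  (\<open>normalize_chain\<close>). Scaling a generator by \<open>c\<close> multiplies its products by \<open>\<sigma>(c) c\<close>: in the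
  hermitian case this leaves a sign, which becomes \<open>\<epsilon>\<^sub>k\<close>; in the bilinear case any nonzero value can
  be reached, and the value \<open>\<i>\<close> is chosen.

  Of each pair \<open>J(l) \<oplus> J(cnj l)\<close> only the eigenvalue in the upper half plane is treated this way. If
  \<open>Q\<close> is its matrix of chain vectors, then \<open>\<i> cnj Q\<close> belongs to the conjugate eigenvalue, and
  \<open>x\<^sup>* H (\<i> cnj y) = \<i> cnj (x\<^sup>T H y)\<close>, so the value \<open>\<i>\<close> turns into \<open>\<i> cnj \<i> = 1\<close> and the hermitian
  Gram matrix of \<open>[Q | \<i> cnj Q]\<close> is a sip matrix. The map \<open>Q \<mapsto> \<i> cnj Q\<close> is an involution, which
  also settles the pairs listed with the lower eigenvalue first. The assembled \<open>N\<close> is invertible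
  because \<open>N\<^sup>* H N = P\<close> and \<open>P\<^sup>2 = 1\<close>.
\<close>

section \<open>Jordan chains and sesquilinear forms\<close>

lemma smult_zero_vec [simp]: "(c :: 'a :: mult_zero) \<cdot>\<^sub>v 0\<^sub>v n = 0\<^sub>v n"
  by (intro eq_vecI) auto

definition shift :: "'a :: comm_ring_1 mat \<Rightarrow> 'a \<Rightarrow> 'a vec \<Rightarrow> 'a vec" where
  "shift A l v = A *\<^sub>v v - l \<cdot>\<^sub>v v"

lemma shift_carrier:
  assumes "A \<in> carrier_mat n n" "v \<in> carrier_vec n"
  shows "(shift A l ^^ s) v \<in> carrier_vec n"
  by (induction s) (use assms in \<open>auto simp: shift_def\<close>)

lemma shift_zero:
  assumes "A \<in> carrier_mat n n"
  shows "(shift A l ^^ s) (0\<^sub>v n) = 0\<^sub>v n"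
proof (induction s)
  case (Suc s)
  have "shift A l (0\<^sub>v n) = 0\<^sub>v n"
    using assms by (intro eq_vecI) (auto simp: shift_def)
  with Suc show ?case by simp
qed simp

lemma shift_add_smult:
  assumes A: "A \<in> carrier_mat n n" and u: "u \<in> carrier_vec n" and v: "v \<in> carrier_vec n"
  shows "(shift A l ^^ s) (u + c \<cdot>\<^sub>v v) = (shift A l ^^ s) u + c \<cdot>\<^sub>v (shift A l ^^ s) v"
proof (induction s)
  case (Suc s)
  have *: "shift A l (u + c \<cdot>\<^sub>v v) = shift A l u + c \<cdot>\<^sub>v shift A l v"
    if "u \<in> carrier_vec n" "v \<in> carrier_vec n" for u v
    using that A by (intro eq_vecI)
      (auto simp: shift_def scalar_prod_add_distrib[of _ n] algebra_simps mult_add_distrib_mat_vec[of _ n n] mult_mat_vec[of _ n n])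
  show ?case using Suc shift_carrier[OF A u] shift_carrier[OF A v] by (simp add: *)
qed simp

lemma shift_smult:
  assumes A: "A \<in> carrier_mat n n" and v: "v \<in> carrier_vec n"
  shows "(shift A l ^^ s) (c \<cdot>\<^sub>v v) = c \<cdot>\<^sub>v (shift A l ^^ s) v"
proof -
  have "(shift A l ^^ s) (0\<^sub>v n + c \<cdot>\<^sub>v v) = c \<cdot>\<^sub>v (shift A l ^^ s) v"
    unfolding shift_add_smult[OF A zero_carrier_vec v] shift_zero[OF A]
    using shift_carrier[OF A v] by simp
  thus ?thesis using v by simp
qed

lemma shift_beyond:
  assumes A: "A \<in> carrier_mat n n" and "(shift A l ^^ m) v = 0\<^sub>v n" "m \<le> s"
  shows "(shift A l ^^ s) v = 0\<^sub>v n"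
proof -
  have "(shift A l ^^ (s - m + m)) v = 0\<^sub>v n"
    unfolding funpow_add using assms by (simp add: shift_zero)
  thus ?thesis using assms by simp
qed

definition sesq_form :: "('a :: comm_ring_1 \<Rightarrow> 'a) \<Rightarrow> 'a mat \<Rightarrow> 'a vec \<Rightarrow> 'a vec \<Rightarrow> 'a" where
  "sesq_form \<sigma> H x y = map_vec \<sigma> x \<bullet> (H *\<^sub>v y)"

text \<open>
  The automorphism \<open>\<sigma>\<close> is a parameter so that the hermitian theory (\<open>\<sigma>\<close> conjugation) and the complex
  symmetric theory (\<open>\<sigma>\<close> the identity) are developed once.
\<close>
locale selfadjoint_pair = field_hom \<sigma> for \<sigma> :: "'a :: field_char_0 \<Rightarrow> 'a" +
  fixes n :: nat and H A :: "'a mat"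
  assumes invol: "\<sigma> (\<sigma> a) = a"
    and H: "H \<in> carrier_mat n n"
    and A: "A \<in> carrier_mat n n"
    and hermitian: "(map_mat \<sigma> H)\<^sup>T = H"
    and selfadjoint: "(map_mat \<sigma> A)\<^sup>T * H = H * A"
begin

abbreviation form where "form \<equiv> sesq_form \<sigma> H"

lemma form_add_smult_left:
  assumes "u \<in> carrier_vec n" "v \<in> carrier_vec n" "w \<in> carrier_vec n"
  shows "form (u + c \<cdot>\<^sub>v v) w = form u w + \<sigma> c * form v w"
proof -
  have "map_vec \<sigma> (u + c \<cdot>\<^sub>v v) = map_vec \<sigma> u + \<sigma> c \<cdot>\<^sub>v map_vec \<sigma> v"
    using assms by (intro eq_vecI) (auto simp: hom_add hom_mult)
  thus ?thesis using assms H
    by (simp add: sesq_form_def add_scalar_prod_distrib[of _ n])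
qed

lemma form_add_smult_right:
  assumes "u \<in> carrier_vec n" "v \<in> carrier_vec n" "w \<in> carrier_vec n"
  shows "form w (u + c \<cdot>\<^sub>v v) = form w u + c * form w v"
  using assms H
  by (simp add: sesq_form_def mult_add_distrib_mat_vec[of _ n n] mult_mat_vec[of _ n n]
      scalar_prod_add_distrib[of _ n])

lemma form_zero [simp]:
  assumes "v \<in> carrier_vec n"
  shows "form v (0\<^sub>v n) = 0" "form (0\<^sub>v n) v = 0"
proof -
  have "H *\<^sub>v 0\<^sub>v n = 0\<^sub>v n" using H by (intro eq_vecI) auto
  thus "form v (0\<^sub>v n) = 0" using assms by (simp add: sesq_form_def)
  have "map_vec \<sigma> (0\<^sub>v n) = 0\<^sub>v n" by (intro eq_vecI) auto
  thus "form (0\<^sub>v n) v = 0"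
    unfolding sesq_form_def using assms H by (metis mult_mat_vec_carrier scalar_prod_left_zero)
qed

lemma form_hermitian:
  assumes x: "x \<in> carrier_vec n" and y: "y \<in> carrier_vec n"
  shows "form y x = \<sigma> (form x y)"
proof -
  have m: "map_vec \<sigma> (map_vec \<sigma> x) = x" by (intro eq_vecI) (auto simp: invol)
  have "\<sigma> (form x y) = map_vec \<sigma> (map_vec \<sigma> x) \<bullet> map_vec \<sigma> (H *\<^sub>v y)"
    unfolding sesq_form_def using x y H by (simp add: scalar_prod_def hom_sum hom_mult)
  also have "\<dots> = x \<bullet> (map_mat \<sigma> H *\<^sub>v map_vec \<sigma> y)"
    unfolding m mult_mat_vec_hom[OF H y] ..
  also have "\<dots> = (map_mat \<sigma> H *\<^sub>v map_vec \<sigma> y) \<bullet> x"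
    using x y H by (intro comm_scalar_prod[of _ n]) auto
  also have "\<dots> = map_vec \<sigma> y \<bullet> ((map_mat \<sigma> H)\<^sup>T *\<^sub>v x)"
    using x y H transpose_vec_mult_scalar[of "(map_mat \<sigma> H)\<^sup>T" n n x "map_vec \<sigma> y"]
    by simp
  finally show ?thesis by (simp add: hermitian sesq_form_def)
qed

lemma form_selfadjoint:
  assumes x: "x \<in> carrier_vec n" and y: "y \<in> carrier_vec n"
  shows "form (A *\<^sub>v x) y = form x (A *\<^sub>v y)"
proof -
  have "form (A *\<^sub>v x) y = (map_mat \<sigma> A *\<^sub>v map_vec \<sigma> x) \<bullet> (H *\<^sub>v y)"
    unfolding sesq_form_def mult_mat_vec_hom[OF A x] ..
  also have "\<dots> = map_vec \<sigma> x \<bullet> ((map_mat \<sigma> A)\<^sup>T *\<^sub>v (H *\<^sub>v y))"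
  proof -
    let ?B = "map_mat \<sigma> A" and ?v = "map_vec \<sigma> x" and ?w = "H *\<^sub>v y"
    have "(?B *\<^sub>v ?v) \<bullet> ?w = ?w \<bullet> (?B *\<^sub>v ?v)"
      using x y A H by (intro comm_scalar_prod[of _ n]) auto
    also have "\<dots> = (?B\<^sup>T *\<^sub>v ?w) \<bullet> ?v"
      using x y A H by (intro transpose_vec_mult_scalar[symmetric, of _ n n]) auto
    also have "\<dots> = ?v \<bullet> (?B\<^sup>T *\<^sub>v ?w)"
      using x y A H by (intro comm_scalar_prod[of _ n]) auto
    finally show ?thesis .
  qed
  also have "(map_mat \<sigma> A)\<^sup>T *\<^sub>v (H *\<^sub>v y) = ((map_mat \<sigma> A)\<^sup>T * H) *\<^sub>v y"
    using A H y by (subst assoc_mult_mat_vec[of _ n n _ n]) auto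
  also have "\<dots> = H *\<^sub>v (A *\<^sub>v y)"
    unfolding selfadjoint using A H y by (subst assoc_mult_mat_vec[of _ n n _ n]) auto
  finally show ?thesis by (simp add: sesq_form_def)
qed

lemma form_minus_smult_left:
  assumes "u \<in> carrier_vec n" "v \<in> carrier_vec n" "w \<in> carrier_vec n"
  shows "form (u - c \<cdot>\<^sub>v v) w = form u w - \<sigma> c * form v w"
proof -
  have "u - c \<cdot>\<^sub>v v = u + (- c) \<cdot>\<^sub>v v" using assms by (intro eq_vecI) auto
  thus ?thesis using form_add_smult_left[OF assms, of "- c"] by (simp add: hom_uminus)
qed

lemma form_minus_smult_right:
  assumes "u \<in> carrier_vec n" "v \<in> carrier_vec n" "w \<in> carrier_vec n"
  shows "form w (u - c \<cdot>\<^sub>v v) = form w u - c * form w v"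
proof -
  have "u - c \<cdot>\<^sub>v v = u + (- c) \<cdot>\<^sub>v v" using assms by (intro eq_vecI) auto
  thus ?thesis using form_add_smult_right[OF assms, of "- c"] by simp
qed

text \<open>
  Comparing \<open>form (A x) y = form x (A y)\<close> with \<open>A x = l x + x'\<close> and \<open>A y = l' y + y'\<close> gives
  \<open>(\<sigma> l - l') form x y = form x y' - form x' y\<close>, where \<open>x'\<close> and \<open>y'\<close> are annihilated by a smaller
  power of their shift.
\<close>
lemma generalized_eigenvectors_orthogonal:
  assumes "\<sigma> l \<noteq> l'"
    and "x \<in> carrier_vec n" "y \<in> carrier_vec n"
    and "(shift A l ^^ m) x = 0\<^sub>v n" "(shift A l' ^^ m') y = 0\<^sub>v n"
  shows "form x y = 0"
  using assms(2-)
proof (induction "m + m'" arbitrary: m m' x y rule: less_induct)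
  case less
  show ?case
  proof (cases "m = 0 \<or> m' = 0")
    case True
    thus ?thesis using less.prems by auto
  next
    case False
    then obtain k k' where k: "m = Suc k" "m' = Suc k'" by (metis not0_implies_Suc)
    note c = shift_carrier[OF A less.prems(1), of 1 l] shift_carrier[OF A less.prems(2), of 1 l']
    have 1: "form (shift A l x) y = 0"
      by (rule less.hyps[of k m']) (use less.prems c k in \<open>auto simp: funpow_swap1\<close>)
    have 2: "form x (shift A l' y) = 0"
      by (rule less.hyps[of m k']) (use less.prems c k in \<open>auto simp: funpow_swap1\<close>)
    have "form (A *\<^sub>v x) y = \<sigma> l * form x y"
      using 1 less.prems A unfolding shift_def by (subst (asm) form_minus_smult_left) auto
    moreover have "form x (A *\<^sub>v y) = l' * form x y"
      using 2 less.prems A unfolding shift_def by (subst (asm) form_minus_smult_right) auto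
    ultimately have "\<sigma> l * form x y = l' * form x y"
      using form_selfadjoint[OF less.prems(1,2)] by metis
    thus ?thesis using assms(1) by simp
  qed
qed

text \<open>
  If \<open>\<sigma> l = l\<close>, the product of the \<open>a\<close>-th and the \<open>b\<close>-th vector of two chains is the moment at
  \<open>a + b\<close>, so the moments record the (Hankel) Gram matrix of a pair of chains.
\<close>
definition moment :: "'a \<Rightarrow> 'a vec \<Rightarrow> 'a vec \<Rightarrow> nat \<Rightarrow> 'a" where
  "moment l x y s = form x ((shift A l ^^ s) y)"

lemma moment_add_smult_right:
  assumes "x \<in> carrier_vec n" "u \<in> carrier_vec n" "v \<in> carrier_vec n"
  shows "moment l x (u + c \<cdot>\<^sub>v (shift A l ^^ k) v) s = moment l x u s + c * moment l x v (s + k)"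
  using assms shift_carrier[OF A]
  by (simp add: moment_def shift_add_smult[OF A] form_add_smult_right funpow_add)

lemma moment_beyond:
  assumes "x \<in> carrier_vec n" "(shift A l ^^ m) y = 0\<^sub>v n" "m \<le> s"
  shows "moment l x y s = 0"
  using assms shift_beyond[OF A assms(2,3)] by (simp add: moment_def)

context
  fixes l :: 'a
  assumes l: "\<sigma> l = l"
begin

lemma shift_selfadjoint:
  assumes x: "x \<in> carrier_vec n" and y: "y \<in> carrier_vec n"
  shows "form ((shift A l ^^ a) x) ((shift A l ^^ b) y) = moment l x y (a + b)"
  unfolding moment_def
proof (induction a arbitrary: b)
  case (Suc a)
  note cx = shift_carrier[OF A x] and cy = shift_carrier[OF A y]
  have *: "form (shift A l u) v = form u (shift A l v)"
    if "u \<in> carrier_vec n" "v \<in> carrier_vec n" for u v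
    unfolding shift_def using that A
    by (simp add: form_minus_smult_left form_minus_smult_right form_selfadjoint l)
  have "form ((shift A l ^^ Suc a) x) ((shift A l ^^ b) y)
      = form ((shift A l ^^ a) x) ((shift A l ^^ Suc b) y)"
    using *[OF cx cy] by simp
  thus ?case using Suc by (metis add_Suc add_Suc_right)
qed simp

lemma moment_hermitian:
  assumes x: "x \<in> carrier_vec n" and y: "y \<in> carrier_vec n"
  shows "moment l y x s = \<sigma> (moment l x y s)"
  using shift_selfadjoint[OF x y, of s 0] form_hermitian[OF shift_carrier[OF A x] y]
  by (simp add: moment_def)

lemma moment_add_smult_left:
  assumes "x \<in> carrier_vec n" "u \<in> carrier_vec n" "v \<in> carrier_vec n"
  shows "moment l (u + c \<cdot>\<^sub>v (shift A l ^^ k) v) x s = moment l u x s + \<sigma> c * moment l v x (s + k)"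
  using assms shift_carrier[OF A] shift_selfadjoint[OF assms(3,1), of k s]
  by (simp add: moment_def form_add_smult_left add.commute)

lemma moment_beyond_left:
  assumes "x \<in> carrier_vec n" "y \<in> carrier_vec n" "(shift A l ^^ m) y = 0\<^sub>v n" "m \<le> s"
  shows "moment l y x s = 0"
  using moment_beyond[OF assms(1,3,4)] moment_hermitian[OF assms(1,2)] by simp

end

end

section \<open>Orthogonal and normalized chains\<close>

context selfadjoint_pair
begin

definition chains :: "'a \<Rightarrow> 'i set \<Rightarrow> ('i \<Rightarrow> nat) \<Rightarrow> ('i \<Rightarrow> 'a vec) \<Rightarrow> bool" where
  "chains l I m x \<longleftrightarrow>
     (\<forall>i\<in>I. 0 < m i \<and> x i \<in> carrier_vec n \<and> (shift A l ^^ m i) (x i) = 0\<^sub>v n)"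

text \<open>
  The vector \<open>(shift A l ^^ (m i - 1)) (x i)\<close> is the eigenvector at the end of the \<open>i\<close>-th chain. The condition
  says that no nontrivial combination of these eigenvectors is orthogonal to all generators. On the
  span of the chains this is equivalent to independence of the chains together with nondegeneracy of the form,
  but it involves one coefficient per chain only and survives a change of generators easily.
\<close>
definition nondegenerate :: "'a \<Rightarrow> 'i set \<Rightarrow> ('i \<Rightarrow> nat) \<Rightarrow> ('i \<Rightarrow> 'a vec) \<Rightarrow> bool" where
  "nondegenerate l I m x \<longleftrightarrow>
     (\<forall>c. (\<forall>k\<in>I. (\<Sum>i\<in>I. c i * moment l (x k) (x i) (m i - 1)) = 0) \<longrightarrow> (\<forall>i\<in>I. c i = 0))"

definition perp :: "'a \<Rightarrow> 'a vec \<Rightarrow> 'a vec \<Rightarrow> bool" where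
  "perp l w x \<longleftrightarrow> (\<forall>s. moment l w x s = 0)"

context
  fixes l :: 'a
  assumes l: "\<sigma> l = l"
begin

lemma perp_sym:
  assumes "x \<in> carrier_vec n" "y \<in> carrier_vec n" "perp l x y"
  shows "perp l y x"
  using assms moment_hermitian[OF l assms(1,2)] by (simp add: perp_def)

text \<open>
  If no chain of maximal length has a nonzero product between its ends, then nondegeneracy still
  gives two such chains \<open>i\<close>, \<open>k\<close> with a nonzero mutual product: the end of the \<open>i\<close>-th chain is
  orthogonal to the generators of all shorter chains. Adding \<open>e\<close> times the \<open>k\<close>-th generator to the \<open>i\<close>-th one
  with \<open>e\<close> the inverse of that product makes the new product \<open>1 + 1\<close>.
  The last clause states, through orthogonal complements, that the span does not grow.
\<close>
lemma exists_pivot: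
  assumes fin: "finite I" and ne: "I \<noteq> {}"
    and ch: "chains l I m x" and nd: "nondegenerate l I m x"
  obtains i x' where "i \<in> I" "\<And>j. j \<in> I \<Longrightarrow> m j \<le> m i"
    "chains l I m x'" "nondegenerate l I m x'" "moment l (x' i) (x' i) (m i - 1) \<noteq> 0"
    "\<And>w. w \<in> carrier_vec n \<Longrightarrow> \<forall>k\<in>I. perp l w (x k) \<Longrightarrow> \<forall>k\<in>I. perp l w (x' k)"
proof -
  define M where "M = Max (m ` I)"
  have M: "m j \<le> M" if "j \<in> I" for j using that fin by (simp add: M_def)
  have "M \<in> m ` I" using fin ne by (simp add: M_def)
  then obtain i where i: "i \<in> I" "m i = M" by auto
  have m: "0 < m j" and x: "x j \<in> carrier_vec n" and nil: "(shift A l ^^ m j) (x j) = 0\<^sub>v n"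
    if "j \<in> I" for j using ch that by (auto simp: chains_def)
  show thesis
  proof (cases "\<exists>j\<in>I. m j = M \<and> moment l (x j) (x j) (M - 1) \<noteq> 0")
    case True
    then obtain j where "j \<in> I" "m j = M" "moment l (x j) (x j) (M - 1) \<noteq> 0" by auto
    with ch nd M show thesis by (intro that[of j x]) auto
  next
    case False
    define g where "g a b = moment l (x a) (x b) (M - 1)" for a b
    have herm: "g b a = \<sigma> (g a b)" if "a \<in> I" "b \<in> I" for a b
      unfolding g_def by (intro moment_hermitian[OF l]) (use x that in auto)
    obtain k where k: "k \<in> I" "g k i \<noteq> 0"
    proof (rule ccontr)
      assume "\<not> thesis"
      hence z: "g k i = 0" if "k \<in> I" for k using that \<open>\<And>k. k \<in> I \<Longrightarrow> g k i \<noteq> 0 \<Longrightarrow> thesis\<close> by blast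
      have "(\<Sum>j\<in>I. of_bool (j = i) * moment l (x k) (x j) (m j - 1)) = 0" if "k \<in> I" for k
      proof -
        have "(\<Sum>j\<in>I. of_bool (j = i) * moment l (x k) (x j) (m j - 1)) = (\<Sum>j\<in>I. 0)"
          using z[OF that] i by (intro sum.cong) (auto simp: g_def of_bool_def)
        thus ?thesis by simp
      qed
      hence "of_bool (i = i) = (0 :: 'a)"
        using nd[unfolded nondegenerate_def, rule_format, of "\<lambda>j. of_bool (j = i)" i] i by simp
      thus False by simp
    qed
    have mk: "m k = M"
    proof (rule ccontr)
      assume "m k \<noteq> M"
      hence "m k \<le> M - 1" using M[OF k(1)] by simp
      hence "g k i = 0" unfolding g_def
        by (intro moment_beyond_left[OF l]) (use x k i nil in auto)
      thus False using k by simp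
    qed
    have diag: "g i i = 0" "g k k = 0" using False i k mk by (auto simp: g_def)
    hence ki: "k \<noteq> i" using k by auto
    define e where "e = 1 / g i k"
    have gik: "g i k \<noteq> 0" using herm[OF i(1) k(1)] k(2) by auto
    define x' where "x' = x(i := x i + e \<cdot>\<^sub>v x k)"
    have right: "moment l w (x i + e \<cdot>\<^sub>v x k) s = moment l w (x i) s + e * moment l w (x k) s"
      if "w \<in> carrier_vec n" for w s
      using moment_add_smult_right[of w "x i" "x k" l e 0 s] that x i k by simp
    have left: "moment l (x i + e \<cdot>\<^sub>v x k) w s = moment l (x i) w s + \<sigma> e * moment l (x k) w s"
      if "w \<in> carrier_vec n" for w s
      using moment_add_smult_left[OF l, of w "x i" "x k" e 0 s] that x i k by simp
    have x'i: "x i + e \<cdot>\<^sub>v x k \<in> carrier_vec n" using x i k by simp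
    have "moment l (x' i) (x' i) (M - 1) = e * g i k + \<sigma> e * g k i"
      using x i k x'i diag by (simp add: x'_def left right g_def algebra_simps)
    also have "\<dots> = 2"
      using gik k herm[OF i(1) k(1)] by (simp add: e_def hom_distribs)
    finally have piv: "moment l (x' i) (x' i) (m i - 1) \<noteq> 0" using i by simp
    have ch': "chains l I m x'"
      unfolding chains_def
    proof
      fix j assume j: "j \<in> I"
      show "0 < m j \<and> x' j \<in> carrier_vec n \<and> (shift A l ^^ m j) (x' j) = 0\<^sub>v n"
      proof (cases "j = i")
        case True
        thus ?thesis using m[OF i(1)] nil[OF i(1)] nil[OF k(1)] x'i mk i
          by (simp add: x'_def shift_add_smult[OF A x[OF i(1)] x[OF k(1)]])
      qed (use m x nil j in \<open>simp add: x'_def\<close>)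
    qed
    have nd': "nondegenerate l I m x'"
      unfolding nondegenerate_def
    proof (intro allI impI)
      fix c assume c: "\<forall>a\<in>I. (\<Sum>j\<in>I. c j * moment l (x' a) (x' j) (m j - 1)) = 0"
      \<comment> \<open>The coefficients of the same vector with respect to the old generators.\<close>
      define d where "d = c(k := c k + e * c i)"
      have sum_eq: "(\<Sum>j\<in>I. c j * moment l w (x' j) (m j - 1))
          = (\<Sum>j\<in>I. d j * moment l w (x j) (m j - 1))" if w: "w \<in> carrier_vec n" for w
      proof -
        have s: "(\<Sum>j\<in>I. f j) = f i + (f k + (\<Sum>j\<in>I-{i}-{k}. f j))" for f :: "_ \<Rightarrow> 'a"
          using fin i k ki by (simp add: sum.remove)
        have "(\<Sum>j\<in>I-{i}-{k}. c j * moment l w (x' j) (m j - 1))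
            = (\<Sum>j\<in>I-{i}-{k}. d j * moment l w (x j) (m j - 1))"
          by (intro sum.cong) (auto simp: d_def x'_def)
        thus ?thesis using ki w mk i
          unfolding s by (simp add: d_def x'_def right algebra_simps)
      qed
      have other: "(\<Sum>j\<in>I. d j * moment l (x a) (x j) (m j - 1)) = 0" if a: "a \<in> I" "a \<noteq> i" for a
        using c a sum_eq[of "x a"] x by (auto simp: x'_def)
      have "(\<Sum>j\<in>I. d j * moment l (x' i) (x j) (m j - 1)) = 0"
        using c i sum_eq[of "x' i"] ch' by (auto simp: chains_def)
      moreover have "(\<Sum>j\<in>I. d j * moment l (x' i) (x j) (m j - 1))
          = (\<Sum>j\<in>I. d j * moment l (x i) (x j) (m j - 1))
            + \<sigma> e * (\<Sum>j\<in>I. d j * moment l (x k) (x j) (m j - 1))"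
        unfolding sum_distrib_left sum.distrib[symmetric]
        by (intro sum.cong) (auto simp: x'_def left x algebra_simps)
      ultimately have "(\<Sum>j\<in>I. d j * moment l (x i) (x j) (m j - 1)) = 0"
        using other[OF k(1) ki] by simp
      with other have "\<forall>a\<in>I. (\<Sum>j\<in>I. d j * moment l (x a) (x j) (m j - 1)) = 0" by metis
      hence d0: "\<forall>j\<in>I. d j = 0"
        using nd[unfolded nondegenerate_def, THEN spec, of d] by simp
      hence "c i = 0" using i ki by (auto simp: d_def)
      show "\<forall>j\<in>I. c j = 0"
      proof
        fix j assume j: "j \<in> I"
        show "c j = 0" using d0[rule_format, OF j] \<open>c i = 0\<close> by (cases "j = k") (auto simp: d_def)
      qed
    qed
    show thesis
    proof (rule that[OF i(1) _ ch' nd' piv])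
      show "m j \<le> m i" if "j \<in> I" for j using M that i by simp
      show "\<forall>a\<in>I. perp l w (x' a)" if "w \<in> carrier_vec n" "\<forall>a\<in>I. perp l w (x a)" for w
        using that i k by (auto simp: perp_def x'_def right)
    qed
  qed
qed

text \<open>
  The moments of \<open>x\<close> and \<open>y\<close> are removed one at a time from the highest position down. Those at
  positions \<open>m'\<close> and above vanish from the start, so \<open>y\<close> is changed only by multiples of
  \<open>(shift A l ^^ k) x\<close> with \<open>k \<ge> m - m'\<close>. These are annihilated by the \<open>m'\<close>-th power of the shift, which
  keeps the length of the chain of \<open>y\<close>; the term \<open>k = m - m'\<close> alone changes its final eigenvector.
\<close>
lemma orthogonalize_against_chain:
  assumes x: "x \<in> carrier_vec n" and y: "y \<in> carrier_vec n"
    and nx: "(shift A l ^^ m) x = 0\<^sub>v n" and ny: "(shift A l ^^ m') y = 0\<^sub>v n"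
    and m: "0 < m'" "m' \<le> m" and piv: "moment l x x (m - 1) \<noteq> 0"
  obtains y' d where "y' \<in> carrier_vec n" "(shift A l ^^ m') y' = 0\<^sub>v n" "perp l x y'"
    "(shift A l ^^ (m' - 1)) y' = (shift A l ^^ (m' - 1)) y + d \<cdot>\<^sub>v (shift A l ^^ (m - 1)) x"
    "\<And>w s. w \<in> carrier_vec n \<Longrightarrow> perp l x w \<Longrightarrow> moment l y' w s = moment l y w s"
proof -
  have "\<exists>y' d. y' \<in> carrier_vec n \<and> (shift A l ^^ m') y' = 0\<^sub>v n \<and>
      (\<forall>s\<ge>m - k. moment l x y' s = 0) \<and>
      (shift A l ^^ (m' - 1)) y' = (shift A l ^^ (m' - 1)) y + d \<cdot>\<^sub>v (shift A l ^^ (m - 1)) x \<and>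
      (\<forall>w\<in>carrier_vec n. perp l x w \<longrightarrow> (\<forall>s. moment l y' w s = moment l y w s))"
    if "m - m' \<le> k" "k \<le> m" for k
    using that
  proof (induction rule: dec_induct)
    case base
    show ?case
    proof (intro exI[of _ y] exI[of _ 0] conjI)
      show "\<forall>s\<ge>m - (m - m'). moment l x y s = 0"
        using moment_beyond[OF x ny] m by simp
      show "(shift A l ^^ (m' - 1)) y
          = (shift A l ^^ (m' - 1)) y + 0 \<cdot>\<^sub>v (shift A l ^^ (m - 1)) x"
        using shift_carrier[OF A x, of "m - 1" l] shift_carrier[OF A y, of "m' - 1" l] by (intro eq_vecI) auto
    qed (use y ny in auto)
  next
    case (step k)
    then obtain y' d where y': "y' \<in> carrier_vec n" and ny': "(shift A l ^^ m') y' = 0\<^sub>v n"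
      and o: "\<And>s. s \<ge> m - k \<Longrightarrow> moment l x y' s = 0"
      and soc: "(shift A l ^^ (m' - 1)) y' = (shift A l ^^ (m' - 1)) y + d \<cdot>\<^sub>v (shift A l ^^ (m - 1)) x"
      and eq: "\<And>w s. w \<in> carrier_vec n \<Longrightarrow> perp l x w \<Longrightarrow> moment l y' w s = moment l y w s"
      by auto
    note cx = shift_carrier[OF A x] and cy = shift_carrier[OF A y]
    define c where "c = - moment l x y' (m - 1 - k) / moment l x x (m - 1)"
    define y'' where "y'' = y' + c \<cdot>\<^sub>v (shift A l ^^ k) x"
    have shift_y'': "(shift A l ^^ s) y'' = (shift A l ^^ s) y' + c \<cdot>\<^sub>v (shift A l ^^ (s + k)) x" for s
      unfolding y''_def using shift_add_smult[OF A y' cx] by (simp add: funpow_add)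
    have "\<exists>d. (shift A l ^^ (m' - 1)) y'' = (shift A l ^^ (m' - 1)) y + d \<cdot>\<^sub>v (shift A l ^^ (m - 1)) x"
    proof (cases "k = m - m'")
      case True
      hence "m' - 1 + k = m - 1" using m by simp
      thus ?thesis using cx cy unfolding shift_y'' soc
        by (intro exI[of _ "d + c"]) (simp add: add_smult_distrib_vec assoc_add_vec[of _ n])
    next
      case False
      hence "(shift A l ^^ (m' - 1 + k)) x = 0\<^sub>v n"
        using step m by (intro shift_beyond[OF A nx]) auto
      thus ?thesis using cx cy unfolding shift_y'' soc by (intro exI[of _ d]) simp
    qed
    then obtain d' where d': "(shift A l ^^ (m' - 1)) y''
        = (shift A l ^^ (m' - 1)) y + d' \<cdot>\<^sub>v (shift A l ^^ (m - 1)) x" ..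
    show ?case
    proof (intro exI[of _ y''] exI[of _ d'] conjI d')
      show "y'' \<in> carrier_vec n" using y' cx by (simp add: y''_def)
      have "(shift A l ^^ (m' + k)) x = 0\<^sub>v n"
        using step by (intro shift_beyond[OF A nx]) auto
      thus "(shift A l ^^ m') y'' = 0\<^sub>v n" unfolding shift_y'' ny' by simp
      show "\<forall>s\<ge>m - Suc k. moment l x y'' s = 0"
      proof (intro allI impI)
        fix s assume s: "m - Suc k \<le> s"
        have e: "moment l x y'' s = moment l x y' s + c * moment l x x (s + k)"
          unfolding y''_def by (rule moment_add_smult_right[OF x y' x])
        show "moment l x y'' s = 0"
        proof (cases "s = m - Suc k")
          case True
          hence "s = m - 1 - k" "s + k = m - 1" using step by auto
          thus ?thesis unfolding e c_def using piv by simp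
        next
          case False
          thus ?thesis unfolding e using s step o[of s] moment_beyond[OF x nx, of "s + k"] by simp
        qed
      qed
      show "\<forall>w\<in>carrier_vec n. perp l x w \<longrightarrow> (\<forall>s. moment l y'' w s = moment l y w s)"
        using eq moment_add_smult_left[OF l _ y' x] by (auto simp: y''_def perp_def)
    qed
  qed
  from this[of m] obtain y' d where "y' \<in> carrier_vec n" "(shift A l ^^ m') y' = 0\<^sub>v n"
    "\<And>s. moment l x y' s = 0"
    "(shift A l ^^ (m' - 1)) y' = (shift A l ^^ (m' - 1)) y + d \<cdot>\<^sub>v (shift A l ^^ (m - 1)) x"
    "\<And>w s. w \<in> carrier_vec n \<Longrightarrow> perp l x w \<Longrightarrow> moment l y' w s = moment l y w s" by auto
  thus thesis by (intro that[of y' d]) (auto simp: perp_def)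
qed

text \<open>
  Induction on the number of chains. In the eigenvectors at the ends, orthogonalization against the
  pivot chain is a unitriangular substitution, so a coefficient vector that violates
  nondegeneracy for the remaining chains extends to one for all of them.
\<close>
lemma orthogonal_chains:
  assumes "finite I" "chains l I m x" "nondegenerate l I m x"
  shows "\<exists>y. chains l I m y \<and> (\<forall>i\<in>I. moment l (y i) (y i) (m i - 1) \<noteq> 0) \<and>
           (\<forall>i\<in>I. \<forall>j\<in>I. i \<noteq> j \<longrightarrow> perp l (y i) (y j)) \<and>
           (\<forall>w\<in>carrier_vec n. (\<forall>k\<in>I. perp l w (x k)) \<longrightarrow> (\<forall>k\<in>I. perp l w (y k)))"
  using assms
proof (induction "card I" arbitrary: I x)
  case 0
  thus ?case by (intro exI[of _ x]) auto
next
  case (Suc N)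
  have "I \<noteq> {}" using Suc.hyps(2) by auto
  then obtain i x1 where i: "i \<in> I" and max: "\<And>j. j \<in> I \<Longrightarrow> m j \<le> m i"
    and ch1: "chains l I m x1" and nd1: "nondegenerate l I m x1"
    and piv: "moment l (x1 i) (x1 i) (m i - 1) \<noteq> 0"
    and perp1: "\<And>w. w \<in> carrier_vec n \<Longrightarrow> \<forall>k\<in>I. perp l w (x k) \<Longrightarrow> \<forall>k\<in>I. perp l w (x1 k)"
    using exists_pivot[OF Suc.prems(1) _ Suc.prems(2,3)] by metis
  define I' where "I' = I - {i}"
  have fin': "finite I'" and card': "N = card I'"
    using Suc.prems(1) Suc.hyps(2) i by (auto simp: I'_def)
  have m: "0 < m j" and x1: "x1 j \<in> carrier_vec n" and nil: "(shift A l ^^ m j) (x1 j) = 0\<^sub>v n"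
    if "j \<in> I" for j using ch1 that by (auto simp: chains_def)
  have "\<forall>j\<in>I'. \<exists>y' d. y' \<in> carrier_vec n \<and> (shift A l ^^ m j) y' = 0\<^sub>v n \<and> perp l (x1 i) y' \<and>
    (shift A l ^^ (m j - 1)) y' = (shift A l ^^ (m j - 1)) (x1 j) + d \<cdot>\<^sub>v (shift A l ^^ (m i - 1)) (x1 i) \<and>
    (\<forall>w\<in>carrier_vec n. perp l (x1 i) w \<longrightarrow> (\<forall>s. moment l y' w s = moment l (x1 j) w s))"
    (is "\<forall>j\<in>I'. \<exists>y' d. ?P j y' d")
  proof
    fix j assume "j \<in> I'"
    hence j: "j \<in> I" by (simp add: I'_def)
    show "\<exists>y' d. ?P j y' d"
      using orthogonalize_against_chain[OF x1[OF i] x1[OF j] nil[OF i] nil[OF j] m[OF j] max[OF j] piv]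
      by metis
  qed
  from bchoice[OF this] obtain x2 where "\<forall>j\<in>I'. \<exists>d. ?P j (x2 j) d" ..
  from bchoice[OF this] obtain d where x2: "\<And>j. j \<in> I' \<Longrightarrow> x2 j \<in> carrier_vec n"
    and nil2: "\<And>j. j \<in> I' \<Longrightarrow> (shift A l ^^ m j) (x2 j) = 0\<^sub>v n"
    and perp2: "\<And>j. j \<in> I' \<Longrightarrow> perp l (x1 i) (x2 j)"
    and soc2: "\<And>j. j \<in> I' \<Longrightarrow> (shift A l ^^ (m j - 1)) (x2 j)
        = (shift A l ^^ (m j - 1)) (x1 j) + d j \<cdot>\<^sub>v (shift A l ^^ (m i - 1)) (x1 i)"
    and eq2: "\<And>j w s. j \<in> I' \<Longrightarrow> w \<in> carrier_vec n \<Longrightarrow> perp l (x1 i) w \<Longrightarrow>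
        moment l (x2 j) w s = moment l (x1 j) w s"
    by auto
  have ch2: "chains l I' m x2"
    using x2 nil2 m by (auto simp: chains_def I'_def)
  have nd2: "nondegenerate l I' m x2"
    unfolding nondegenerate_def
  proof (intro allI impI)
    fix c assume c: "\<forall>k\<in>I'. (\<Sum>j\<in>I'. c j * moment l (x2 k) (x2 j) (m j - 1)) = 0"
    \<comment> \<open>The pivot coefficient absorbs the multiples of the pivot eigenvector in \<open>soc2\<close>.\<close>
    define e where "e = c(i := \<Sum>j\<in>I'. c j * d j)"
    have sum_eq: "(\<Sum>j\<in>I. e j * moment l w (x1 j) (m j - 1))
        = (\<Sum>j\<in>I'. c j * moment l w (x2 j) (m j - 1))" if w: "w \<in> carrier_vec n" for w
    proof -
      have mo: "moment l w (x2 j) (m j - 1)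
          = moment l w (x1 j) (m j - 1) + d j * moment l w (x1 i) (m i - 1)" if "j \<in> I'" for j
        unfolding moment_def soc2[OF that] using shift_carrier[OF A x1] w that i
        by (intro form_add_smult_right) (auto simp: I'_def)
      have "(\<Sum>j\<in>I. e j * moment l w (x1 j) (m j - 1))
          = (\<Sum>j\<in>I'. c j * d j) * moment l w (x1 i) (m i - 1)
            + (\<Sum>j\<in>I'. e j * moment l w (x1 j) (m j - 1))"
        using sum.remove[OF Suc.prems(1) i, of "\<lambda>j. e j * moment l w (x1 j) (m j - 1)"]
        by (simp add: e_def I'_def[symmetric])
      also have "(\<Sum>j\<in>I'. e j * moment l w (x1 j) (m j - 1))
          = (\<Sum>j\<in>I'. c j * moment l w (x1 j) (m j - 1))"
        by (intro sum.cong) (auto simp: e_def I'_def)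
      also have "(\<Sum>j\<in>I'. c j * d j) * moment l w (x1 i) (m i - 1) + \<dots>
          = (\<Sum>j\<in>I'. c j * d j * moment l w (x1 i) (m i - 1) + c j * moment l w (x1 j) (m j - 1))"
        by (simp add: sum_distrib_right sum.distrib)
      also have "\<dots> = (\<Sum>j\<in>I'. c j * moment l w (x2 j) (m j - 1))"
        by (intro sum.cong) (simp_all add: mo[unfolded One_nat_def] algebra_simps)
      finally show ?thesis .
    qed
    have "\<forall>k\<in>I. (\<Sum>j\<in>I. e j * moment l (x1 k) (x1 j) (m j - 1)) = 0"
    proof
      fix k assume k: "k \<in> I"
      show "(\<Sum>j\<in>I. e j * moment l (x1 k) (x1 j) (m j - 1)) = 0"
      proof (cases "k = i")
        case True
        thus ?thesis unfolding sum_eq[OF x1[OF k]] using perp2 by (simp add: perp_def)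
      next
        case False
        hence k': "k \<in> I'" using k by (simp add: I'_def)
        have "(\<Sum>j\<in>I'. c j * moment l (x1 k) (x2 j) (m j - 1))
            = (\<Sum>j\<in>I'. c j * moment l (x2 k) (x2 j) (m j - 1))"
          by (intro sum.cong) (simp_all add: eq2[OF k' x2 perp2])
        thus ?thesis unfolding sum_eq[OF x1[OF k]] using c k' by simp
      qed
    qed
    hence "\<forall>j\<in>I. e j = 0"
      using nd1[unfolded nondegenerate_def, THEN spec, of e] by simp
    moreover have "e j = c j" "j \<in> I" if "j \<in> I'" for j using that by (auto simp: I'_def e_def)
    ultimately show "\<forall>j\<in>I'. c j = 0" by metis
  qed
  from Suc.hyps(1)[OF card' fin' ch2 nd2] obtain y where
    Y: "chains l I' m y \<and> (\<forall>i\<in>I'. moment l (y i) (y i) (m i - 1) \<noteq> 0) \<and>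
      (\<forall>i\<in>I'. \<forall>j\<in>I'. i \<noteq> j \<longrightarrow> perp l (y i) (y j)) \<and>
      (\<forall>w\<in>carrier_vec n. (\<forall>k\<in>I'. perp l w (x2 k)) \<longrightarrow> (\<forall>k\<in>I'. perp l w (y k)))" ..
  hence chy: "chains l I' m y"
    and pivy: "\<And>j. j \<in> I' \<Longrightarrow> moment l (y j) (y j) (m j - 1) \<noteq> 0"
    and perpy: "\<And>j k. j \<in> I' \<Longrightarrow> k \<in> I' \<Longrightarrow> j \<noteq> k \<Longrightarrow> perp l (y j) (y k)"
    and spany: "\<And>w. w \<in> carrier_vec n \<Longrightarrow> \<forall>k\<in>I'. perp l w (x2 k) \<Longrightarrow> \<forall>k\<in>I'. perp l w (y k)"
    by simp_all
  have cy: "y j \<in> carrier_vec n" if "j \<in> I'" for j using chy that by (auto simp: chains_def)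
  have iy: "perp l (x1 i) (y j)" "perp l (y j) (x1 i)" if "j \<in> I'" for j
    using spany[OF x1[OF i]] perp2 that perp_sym[OF x1[OF i] cy[OF that]] by blast+
  define z where "z = y(i := x1 i)"
  show ?case
  proof (intro exI[of _ z] conjI ballI impI)
    show "chains l I m z" using chy m x1 nil i by (auto simp: chains_def z_def I'_def)
    show "moment l (z j) (z j) (m j - 1) \<noteq> 0" if "j \<in> I" for j
      using that pivy piv by (auto simp: z_def I'_def)
    show "perp l (z j) (z k)" if "j \<in> I" "k \<in> I" "j \<noteq> k" for j k
      using that perpy iy by (auto simp: z_def I'_def)
    fix w k assume w: "w \<in> carrier_vec n" "\<forall>k\<in>I. perp l w (x k)" and k: "k \<in> I"
    have p1: "\<forall>k\<in>I. perp l w (x1 k)" using perp1 w by blast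
    have "perp l w (x2 j)" if j: "j \<in> I'" for j
    proof -
      have "j \<in> I" using j by (simp add: I'_def)
      hence "perp l (x1 j) w" "perp l (x1 i) w" using p1 perp_sym w x1 i by blast+
      hence "perp l (x2 j) w" using eq2[OF j w(1)] by (simp add: perp_def)
      thus ?thesis using perp_sym w x2 j by blast
    qed
    hence "\<forall>k\<in>I'. perp l w (y k)" using spany w by blast
    thus "perp l w (z k)" using p1 k i by (auto simp: z_def I'_def)
  qed
qed

text \<open>
  With the top moment \<open>a\<close> fixed, adding \<open>c\<close> times the vector \<open>k + 1\<close> steps down the chain to the generator
  changes the moment \<open>k + 1\<close> places below the top by \<open>2 c a\<close> and no moment
  between that place and the top, so all lower moments can be cleared in turn. A final scaling moves \<open>a\<close> into \<open>E\<close>.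
\<close>
lemma normalize_chain:
  assumes x: "x \<in> carrier_vec n" and nx: "(shift A l ^^ m) x = 0\<^sub>v n" and m: "0 < m"
    and piv: "moment l x x (m - 1) \<noteq> 0"
    and E: "\<And>a. a \<noteq> 0 \<Longrightarrow> \<sigma> a = a \<Longrightarrow> \<exists>c. \<sigma> c * c * a \<in> E"
  obtains y e where "y \<in> carrier_vec n" "(shift A l ^^ m) y = 0\<^sub>v n" "e \<in> E"
    "\<And>s. moment l y y s = (if s = m - 1 then e else 0)"
    "\<And>w. w \<in> carrier_vec n \<Longrightarrow> perp l w x \<Longrightarrow> perp l w y"
proof -
  define a where "a = moment l x x (m - 1)"
  have "\<exists>y. y \<in> carrier_vec n \<and> (shift A l ^^ m) y = 0\<^sub>v n \<and>
      (\<forall>s\<ge>m - 1 - k. moment l y y s = (if s = m - 1 then a else 0)) \<and>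
      (\<forall>w\<in>carrier_vec n. perp l w x \<longrightarrow> perp l w y)" if "k \<le> m - 1" for k
    using that
  proof (induction k)
    case 0
    show ?case
      by (intro exI[of _ x]) (use x nx moment_beyond[OF x nx] m in \<open>auto simp: a_def\<close>)
  next
    case (Suc k)
    then obtain y where y: "y \<in> carrier_vec n" and ny: "(shift A l ^^ m) y = 0\<^sub>v n"
      and g: "\<And>s. s \<ge> m - 1 - k \<Longrightarrow> moment l y y s = (if s = m - 1 then a else 0)"
      and span: "\<And>w. w \<in> carrier_vec n \<Longrightarrow> perp l w x \<Longrightarrow> perp l w y" by auto
    note cy = shift_carrier[OF A y]
    define b where "b = moment l y y (m - 2 - k)"
    \<comment> \<open>Both moments are fixed by \<open>\<sigma>\<close>, hence so is \<open>c\<close>, and the two cross terms are equal.\<close>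
    define c where "c = - b / (2 * a)"
    have "\<sigma> a = a" "\<sigma> b = b"
      using moment_hermitian[OF l x x] moment_hermitian[OF l y y] by (simp_all add: a_def b_def)
    hence c: "\<sigma> c = c" by (simp add: c_def hom_distribs)
    define y' where "y' = y + c \<cdot>\<^sub>v (shift A l ^^ Suc k) y"
    have y': "y' \<in> carrier_vec n" using y cy[of "Suc k"] by (simp add: y'_def del: funpow.simps)
    have right: "moment l w y' s = moment l w y s + c * moment l w y (s + Suc k)"
      if "w \<in> carrier_vec n" for w s
      unfolding y'_def by (rule moment_add_smult_right[OF that y y])
    have left: "moment l y' w s = moment l y w s + c * moment l y w (s + Suc k)"
      if "w \<in> carrier_vec n" for w s
      unfolding y'_def using moment_add_smult_left[OF l that y y, of c "Suc k" s] c
      by (simp del: funpow.simps)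
    show ?case
    proof (intro exI[of _ y'] conjI allI impI ballI y')
      have "(shift A l ^^ m) y' = (shift A l ^^ m) y + c \<cdot>\<^sub>v (shift A l ^^ (m + Suc k)) y"
        unfolding y'_def funpow_add o_apply by (rule shift_add_smult[OF A y cy])
      also have "(shift A l ^^ (m + Suc k)) y = 0\<^sub>v n" by (rule shift_beyond[OF A ny]) simp
      finally show "(shift A l ^^ m) y' = 0\<^sub>v n" using ny by simp
      show "perp l w y'" if "w \<in> carrier_vec n" "perp l w x" for w
        using span[OF that] right[OF that(1)] by (simp add: perp_def)
      fix s assume s: "m - 1 - Suc k \<le> s"
      have e: "moment l y' y' s = moment l y y s + 2 * c * moment l y y (s + Suc k)
          + c * c * moment l y y (s + Suc k + Suc k)"
        using left[OF y'] right[OF y] by (simp add: algebra_simps)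
      show "moment l y' y' s = (if s = m - 1 then a else 0)"
      proof (cases "s = m - 1 - Suc k")
        case True
        hence "moment l y y s = b" "s + Suc k = m - 1" "s \<noteq> m - 1"
          using Suc.prems by (auto simp: b_def numeral_2_eq_2)
        moreover from this have "moment l y y (s + Suc k) = a"
          "moment l y y (s + Suc k + Suc k) = 0" using g[of "s + Suc k"] g[of "s + Suc k + Suc k"] by auto
        ultimately show ?thesis unfolding e c_def using piv by (simp add: a_def)
      next
        case False
        thus ?thesis unfolding e
          using s Suc.prems g[of s] g[of "s + Suc k"] g[of "s + Suc k + Suc k"] by auto
      qed
    qed
  qed
  from this[of "m - 1"] obtain y where y: "y \<in> carrier_vec n" and ny: "(shift A l ^^ m) y = 0\<^sub>v n"
    and g: "\<And>s. moment l y y s = (if s = m - 1 then a else 0)"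
    and span: "\<And>w. w \<in> carrier_vec n \<Longrightarrow> perp l w x \<Longrightarrow> perp l w y" by auto
  have "a \<noteq> 0" "\<sigma> a = a" using piv moment_hermitian[OF l x x] by (simp_all add: a_def)
  then obtain c where c: "\<sigma> c * c * a \<in> E" using E by blast
  have r: "moment l w (c \<cdot>\<^sub>v y) s = c * moment l w y s" if "w \<in> carrier_vec n" for w s
    using moment_add_smult_right[OF that zero_carrier_vec y, of l c 0 s] that y
    by (simp add: moment_def shift_zero[OF A])
  have lft: "moment l (c \<cdot>\<^sub>v y) w s = \<sigma> c * moment l y w s" if "w \<in> carrier_vec n" for w s
    using moment_add_smult_left[OF l that zero_carrier_vec y, of c 0 s] that y shift_carrier[OF A that]
    by (simp add: moment_def)
  show thesis
  proof (rule that[OF _ _ c, of "c \<cdot>\<^sub>v y"])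
    show "(shift A l ^^ m) (c \<cdot>\<^sub>v y) = 0\<^sub>v n" unfolding shift_smult[OF A y] ny by simp
    show "perp l w (c \<cdot>\<^sub>v y)" if "w \<in> carrier_vec n" "perp l w x" for w
      using span[OF that] r[OF that(1)] by (simp add: perp_def)
  qed (use y in \<open>auto simp: r lft g\<close>)
qed

theorem flipped_orthogonal_chains:
  assumes fin: "finite I" and ch: "chains l I m x" and nd: "nondegenerate l I m x"
    and E: "\<And>a. a \<noteq> 0 \<Longrightarrow> \<sigma> a = a \<Longrightarrow> \<exists>c. \<sigma> c * c * a \<in> E"
  obtains y e where "chains l I m y" "\<And>i. i \<in> I \<Longrightarrow> e i \<in> E"
    "\<And>i j s. i \<in> I \<Longrightarrow> j \<in> I \<Longrightarrow>
       moment l (y i) (y j) s = (if i = j \<and> s = m i - 1 then e i else 0)"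
proof -
  from orthogonal_chains[OF fin ch nd] obtain x' where ch': "chains l I m x'"
    and piv: "\<And>i. i \<in> I \<Longrightarrow> moment l (x' i) (x' i) (m i - 1) \<noteq> 0"
    and perp: "\<And>i j. i \<in> I \<Longrightarrow> j \<in> I \<Longrightarrow> i \<noteq> j \<Longrightarrow> perp l (x' i) (x' j)" by blast
  have "\<forall>i\<in>I. \<exists>y e. y \<in> carrier_vec n \<and> (shift A l ^^ m i) y = 0\<^sub>v n \<and> e \<in> E \<and>
    (\<forall>s. moment l y y s = (if s = m i - 1 then e else 0)) \<and>
    (\<forall>w\<in>carrier_vec n. perp l w (x' i) \<longrightarrow> perp l w y)"
  proof
    fix i assume i: "i \<in> I"
    have "x' i \<in> carrier_vec n" "(shift A l ^^ m i) (x' i) = 0\<^sub>v n" "0 < m i"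
      using ch' i by (auto simp: chains_def)
    from normalize_chain[OF this piv[OF i] E] show "\<exists>y e. y \<in> carrier_vec n \<and>
      (shift A l ^^ m i) y = 0\<^sub>v n \<and> e \<in> E \<and>
      (\<forall>s. moment l y y s = (if s = m i - 1 then e else 0)) \<and>
      (\<forall>w\<in>carrier_vec n. perp l w (x' i) \<longrightarrow> perp l w y)" by metis
  qed
  from bchoice[OF this] obtain y where "\<forall>i\<in>I. \<exists>e. y i \<in> carrier_vec n \<and>
    (shift A l ^^ m i) (y i) = 0\<^sub>v n \<and> e \<in> E \<and>
    (\<forall>s. moment l (y i) (y i) s = (if s = m i - 1 then e else 0)) \<and>
    (\<forall>w\<in>carrier_vec n. perp l w (x' i) \<longrightarrow> perp l w (y i))" ..
  from bchoice[OF this] obtain e where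
    y: "\<And>i. i \<in> I \<Longrightarrow> y i \<in> carrier_vec n"
    and ny: "\<And>i. i \<in> I \<Longrightarrow> (shift A l ^^ m i) (y i) = 0\<^sub>v n" and e: "\<And>i. i \<in> I \<Longrightarrow> e i \<in> E"
    and g: "\<And>i s. i \<in> I \<Longrightarrow> moment l (y i) (y i) s = (if s = m i - 1 then e i else 0)"
    and span: "\<And>i w. i \<in> I \<Longrightarrow> w \<in> carrier_vec n \<Longrightarrow> perp l w (x' i) \<Longrightarrow> perp l w (y i)"
    by auto
  have "chains l I m y" using y ny ch' by (auto simp: chains_def)
  moreover have "perp l (y i) (y j)" if "i \<in> I" "j \<in> I" "i \<noteq> j" for i j
  proof -
    have x': "x' i \<in> carrier_vec n" "x' j \<in> carrier_vec n" using ch' that by (auto simp: chains_def)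
    have "perp l (x' j) (y i)" using span perp that x' by metis
    hence "perp l (y i) (x' j)" using perp_sym x' y that by blast
    thus ?thesis using span y that by blast
  qed
  hence "moment l (y i) (y j) s = (if i = j \<and> s = m i - 1 then e i else 0)"
    if "i \<in> I" "j \<in> I" for i j s
    using that g by (cases "i = j") (auto simp: perp_def)
  ultimately show thesis using e by (intro that[of y e]) auto
qed

end

end

section \<open>The Gram matrix of a Jordan basis is nondegenerate\<close>

definition block_offset :: "(nat \<times> 'a) list \<Rightarrow> nat \<Rightarrow> nat" where
  "block_offset bs r = sum_list (map fst (take r bs))"

lemma block_offset_Cons [simp]:
  "block_offset (b # bs) 0 = 0" "block_offset (b # bs) (Suc r) = fst b + block_offset bs r"
  by (simp_all add: block_offset_def)

lemma block_offset_add: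
  assumes "r < length bs" "s < length bs" "r < s"
  shows "block_offset bs r + fst (bs ! r) \<le> block_offset bs s"
  using assms
proof (induction bs arbitrary: r s)
  case (Cons b bs)
  from Cons.prems obtain s' where s: "s = Suc s'" by (cases s) auto
  show ?case using Cons s by (cases r) auto
qed simp

lemma block_offset_less:
  assumes "r < length bs" "a < fst (bs ! r)"
  shows "block_offset bs r + a < sum_list (map fst bs)"
  using assms
proof (induction bs arbitrary: r)
  case (Cons b bs)
  thus ?case by (cases r) auto
qed simp

lemma block_position:
  assumes "j < sum_list (map fst bs)"
  obtains r a where "r < length bs" "a < fst (bs ! r)" "j = block_offset bs r + a"
proof -
  from assms have "\<exists>r<length bs. \<exists>a<fst (bs ! r). j = block_offset bs r + a"
  proof (induction bs arbitrary: j)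
    case (Cons b bs)
    show ?case
    proof (cases "j < fst b")
      case True
      thus ?thesis by (intro exI[of _ 0]) auto
    next
      case False
      with Cons.prems have "j - fst b < sum_list (map fst bs)" by simp
      from Cons.IH[OF this] obtain r a where "r < length bs" "a < fst (bs ! r)"
        "j - fst b = block_offset bs r + a" by blast
      with False show ?thesis by (intro exI[of _ "Suc r"]) auto
    qed
  qed simp
  thus thesis using that by blast
qed

lemma jordan_matrix_index:
  assumes "r < length bs" "a < fst (bs ! r)" "i < sum_list (map fst bs)"
  shows "jordan_matrix bs $$ (i, block_offset bs r + a)
    = (if i = block_offset bs r + a then snd (bs ! r)
       else if Suc i = block_offset bs r + a \<and> 0 < a then 1 else 0)"
  using assms
proof (induction bs arbitrary: r i)
  case (Cons b bs)
  obtain k c where b: "b = (k, c)" by force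
  show ?case
  proof (cases r)
    case 0
    thus ?thesis using Cons.prems b by (auto simp: jordan_matrix_Cons)
  next
    case (Suc r')
    have less: "block_offset bs r' + a < sum_list (map fst bs)"
      using Cons.prems Suc by (intro block_offset_less) auto
    show ?thesis
    proof (cases "i < k")
      case True
      thus ?thesis using Cons.prems b Suc less by (auto simp: jordan_matrix_Cons)
    next
      case False
      thus ?thesis using Cons.prems Cons.IH[of r' "i - k"] b Suc less
        by (auto simp: jordan_matrix_Cons)
    qed
  qed
qed simp

definition block_col :: "(nat \<times> 'a) list \<Rightarrow> 'a mat \<Rightarrow> nat \<Rightarrow> nat \<Rightarrow> 'a vec" where
  "block_col bs N r a = col N (block_offset bs r + a)"

text \<open>
  With ones on the superdiagonal the shift moves columns to the left, so a chain is generated by the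
  last column of its block.
\<close>
definition generator :: "(nat \<times> 'a) list \<Rightarrow> 'a mat \<Rightarrow> nat \<Rightarrow> 'a vec" where
  "generator bs N r = block_col bs N r (fst (bs ! r) - 1)"

lemma mult_mat_unit_vec:
  fixes N :: "'a :: comm_ring_1 mat"
  assumes "N \<in> carrier_mat n k" "j < k"
  shows "N *\<^sub>v unit_vec k j = col N j"
  using assms by (intro eq_vecI) auto

lemma shift_block_col:
  fixes A N :: "'a :: field mat"
  assumes A: "A \<in> carrier_mat n n" and N: "N \<in> carrier_mat n n"
    and n: "n = sum_list (map fst bs)" and AN: "A * N = N * jordan_matrix bs"
    and r: "r < length bs" and a: "a < fst (bs ! r)"
  shows "shift A (snd (bs ! r)) (block_col bs N r a)
    = (if a = 0 then 0\<^sub>v n else block_col bs N r (a - 1))"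
proof -
  define j where "j = block_offset bs r + a"
  define l where "l = snd (bs ! r)"
  define u where "u = (if a = 0 then 0\<^sub>v n else unit_vec n (j - 1) :: 'a vec)"
  have j: "j < n" using block_offset_less[OF r a] by (simp add: n j_def)
  have J: "jordan_matrix bs \<in> carrier_mat n n" unfolding n by simp
  have u: "u \<in> carrier_vec n" by (simp add: u_def)
  have Jcol: "col (jordan_matrix bs) j = l \<cdot>\<^sub>v unit_vec n j + u"
  proof (intro eq_vecI)
    fix i assume "i < dim_vec (l \<cdot>\<^sub>v unit_vec n j + u)"
    hence i: "i < n" using u by simp
    have "col (jordan_matrix bs) j $ i = jordan_matrix bs $$ (i, j)"
      by (rule index_col) (use i j n in simp_all)
    also have "\<dots> = (if i = j then l else if Suc i = j \<and> 0 < a then 1 else 0)"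
      unfolding j_def l_def using i by (intro jordan_matrix_index r a) (simp add: n)
    also have "\<dots> = (l \<cdot>\<^sub>v unit_vec n j + u) $ i"
      using i j by (auto simp: u_def j_def)
    finally show "col (jordan_matrix bs) j $ i = (l \<cdot>\<^sub>v unit_vec n j + u) $ i" .
  qed (use J u in auto)
  have Nu: "N *\<^sub>v u = (if a = 0 then 0\<^sub>v n else col N (j - 1))"
  proof (cases "a = 0")
    case True
    thus ?thesis using N by (auto simp: u_def intro!: eq_vecI)
  next
    case False
    thus ?thesis using mult_mat_unit_vec[OF N, of "j - 1"] j by (simp add: u_def)
  qed
  have "A *\<^sub>v col N j = col (A * N) j" using col_mult2[OF A N j] ..
  also have "\<dots> = N *\<^sub>v col (jordan_matrix bs) j"
    unfolding AN using col_mult2[OF N J j] .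
  also have "\<dots> = l \<cdot>\<^sub>v col N j + N *\<^sub>v u"
    unfolding Jcol using N u j
    by (simp add: mult_add_distrib_mat_vec[of _ n n] mult_mat_vec[of _ n n] mult_mat_unit_vec)
  finally have "shift A l (col N j) = N *\<^sub>v u"
    unfolding shift_def using N u j by (intro eq_vecI) auto
  thus ?thesis
    unfolding Nu by (auto simp: l_def j_def block_col_def)
qed

lemma shift_power_block_col:
  fixes A N :: "'a :: field mat"
  assumes A: "A \<in> carrier_mat n n" and N: "N \<in> carrier_mat n n"
    and n: "n = sum_list (map fst bs)" and AN: "A * N = N * jordan_matrix bs"
    and r: "r < length bs" and a: "a < fst (bs ! r)"
  shows "(shift A (snd (bs ! r)) ^^ s) (block_col bs N r a)
    = (if s \<le> a then block_col bs N r (a - s) else 0\<^sub>v n)"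
proof (induction s)
  case (Suc s)
  show ?case
  proof (cases "s \<le> a")
    case True
    thus ?thesis using Suc a by (auto simp: shift_block_col[OF A N n AN r])
  next
    case False
    thus ?thesis using Suc shift_zero[OF A, of 1 "snd (bs ! r)"] by auto
  qed
qed simp

context selfadjoint_pair
begin

lemma form_mult_mat_vec:
  assumes w: "w \<in> carrier_vec n" and N: "N \<in> carrier_mat n k" and v: "v \<in> carrier_vec k"
  shows "form w (N *\<^sub>v v) = (\<Sum>j<k. v $ j * form w (col N j))"
proof -
  define G where "G = H * N"
  have G: "G \<in> carrier_mat n k" using H N by (simp add: G_def)
  have "form w (N *\<^sub>v v) = map_vec \<sigma> w \<bullet> (G *\<^sub>v v)"
    unfolding sesq_form_def G_def by (subst assoc_mult_mat_vec[OF H N v]) simp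
  also have "\<dots> = (\<Sum>i<n. \<Sum>j<k. \<sigma> (w $ i) * (G $$ (i, j) * v $ j))"
    using G v w by (simp add: scalar_prod_def sum_distrib_left lessThan_atLeast0)
  also have "\<dots> = (\<Sum>j<k. \<Sum>i<n. \<sigma> (w $ i) * (G $$ (i, j) * v $ j))"
    by (rule sum.swap)
  also have "\<dots> = (\<Sum>j<k. v $ j * form w (col N j))"
  proof (intro sum.cong refl)
    fix j assume "j \<in> {..<k}"
    hence "j < k" by simp
    hence j: "H *\<^sub>v col N j = col G j" "j < k"
      using col_mult2[OF H N, of j] by (simp_all only: G_def)
    show "(\<Sum>i<n. \<sigma> (w $ i) * (G $$ (i, j) * v $ j)) = v $ j * form w (col N j)"
      unfolding sesq_form_def j using G w j(2)
      by (simp add: scalar_prod_def sum_distrib_left lessThan_atLeast0 ac_simps)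
  qed
  finally show ?thesis .
qed

text \<open>
  Nondegeneracy of the form on the whole space.
\<close>
lemma perpendicular_to_basis:
  assumes Hi: "Hi \<in> carrier_mat n n" "H * Hi = 1\<^sub>m n"
    and N: "N \<in> carrier_mat n n" and Ni: "Ni \<in> carrier_mat n n" "N * Ni = 1\<^sub>m n"
    and z: "z \<in> carrier_vec n" and perp: "\<And>j. j < n \<Longrightarrow> form (col N j) z = 0"
  shows "z = 0\<^sub>v n"
proof -
  have all: "form z w = 0" if w: "w \<in> carrier_vec n" for w
  proof -
    have "w = N *\<^sub>v (Ni *\<^sub>v w)"
      using Ni N w by (metis assoc_mult_mat_vec one_mult_mat_vec)
    also have "form z \<dots> = (\<Sum>j<n. (Ni *\<^sub>v w) $ j * form z (col N j))"
      using Ni w by (intro form_mult_mat_vec[OF z N]) simp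
    also have "\<dots> = 0"
      using perp N z form_hermitian[of "col N _" z] by (intro sum.neutral) auto
    finally show ?thesis .
  qed
  show ?thesis
  proof (intro eq_vecI)
    fix i assume "i < dim_vec (0\<^sub>v n :: 'a vec)"
    hence i: "i < n" by simp
    have "H *\<^sub>v (Hi *\<^sub>v unit_vec n i) = unit_vec n i"
      using H Hi by (metis assoc_mult_mat_vec one_mult_mat_vec unit_vec_carrier)
    moreover have "form z (Hi *\<^sub>v unit_vec n i) = 0" using Hi by (intro all) simp
    ultimately have "\<sigma> (z $ i) = 0" using z i by (simp add: sesq_form_def)
    hence "\<sigma> (\<sigma> (z $ i)) = 0" by simp
    thus "z $ i = 0\<^sub>v n $ i" using i by (simp add: invol)
  qed (use z in simp)
qed

lemma jordan_basis_chains: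
  assumes N: "N \<in> carrier_mat n n" and n: "n = sum_list (map fst bs)"
    and AN: "A * N = N * jordan_matrix bs" and pos: "0 \<notin> fst ` set bs"
  shows "chains l {r. r < length bs \<and> snd (bs ! r) = l} (\<lambda>r. fst (bs ! r)) (generator bs N)"
  unfolding chains_def
proof
  fix r assume "r \<in> {r. r < length bs \<and> snd (bs ! r) = l}"
  hence r: "r < length bs" "snd (bs ! r) = l" by auto
  hence p: "0 < fst (bs ! r)" using pos nth_mem[OF r(1)] by (metis gr0I imageI)
  have "block_offset bs r + (fst (bs ! r) - 1) < n" unfolding n using p r
    by (intro block_offset_less) auto
  hence "generator bs N r \<in> carrier_vec n"
    using N by (auto simp: generator_def block_col_def)
  thus "0 < fst (bs ! r) \<and> generator bs N r \<in> carrier_vec n \<and>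
      (shift A l ^^ fst (bs ! r)) (generator bs N r) = 0\<^sub>v n"
    using shift_power_block_col[OF A N n AN r(1), of "fst (bs ! r) - 1" "fst (bs ! r)"] p r
    by (auto simp: generator_def)
qed

text \<open>
  A combination \<open>z\<close> of eigenvectors for \<open>l\<close> is orthogonal to the chains of all other eigenvalues, and to
  every vector \<open>shift A l x\<close> by selfadjointness. If it is also orthogonal to the generators for \<open>l\<close>, it is
  orthogonal to the whole Jordan basis, hence zero, and its coefficients in that basis vanish.
\<close>
lemma jordan_basis_nondegenerate:
  assumes l: "\<sigma> l = l"
    and Hi: "Hi \<in> carrier_mat n n" "H * Hi = 1\<^sub>m n"
    and N: "N \<in> carrier_mat n n" and Ni: "Ni \<in> carrier_mat n n" "N * Ni = 1\<^sub>m n" "Ni * N = 1\<^sub>m n"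
    and n: "n = sum_list (map fst bs)"
    and AN: "A * N = N * jordan_matrix bs" and pos: "0 \<notin> fst ` set bs"
  shows "nondegenerate l {r. r < length bs \<and> snd (bs ! r) = l} (\<lambda>r. fst (bs ! r)) (generator bs N)"
    (is "nondegenerate l ?I ?m ?x")
  unfolding nondegenerate_def
proof (intro allI impI ballI)
  fix c i
  assume c: "\<forall>k\<in>?I. (\<Sum>i\<in>?I. c i * moment l (?x k) (?x i) (?m i - 1)) = 0" and i: "i \<in> ?I"
  let ?off = "block_offset bs"
  note sh = shift_power_block_col[OF A N n AN]
  have p: "0 < ?m r" if "r < length bs" for r using pos nth_mem[OF that] by (metis gr0I imageI)
  have off: "?off r + a < n" if "r < length bs" "a < ?m r" for r a
    unfolding n using that by (rule block_offset_less)
  have bc: "block_col bs N r a \<in> carrier_vec n" if "r < length bs" "a < ?m r" for r a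
    using N by (auto simp: block_col_def)
  have inj: "r = s" if "r < length bs" "s < length bs" "?off r = ?off s" for r s
    using that block_offset_add[of r bs s] block_offset_add[of s bs r] p[of r] p[of s]
    by (cases r s rule: linorder_cases) auto
  have soc: "(shift A l ^^ (?m r - 1)) (?x r) = block_col bs N r 0" if "r \<in> ?I" for r
    using sh[of r "?m r - 1" "?m r - 1"] p[of r] that by (auto simp: generator_def)
  \<comment> \<open>The coordinates of the combination of eigenvectors, placed at the first columns of the blocks.\<close>
  define v where "v = vec n (\<lambda>j. \<Sum>r\<in>?I. if j = ?off r then c r else 0)"
  define z where "z = N *\<^sub>v v"
  have v: "v \<in> carrier_vec n" by (simp add: v_def)
  have z: "z \<in> carrier_vec n" using N v by (simp add: z_def)
  have form_z: "form w z = (\<Sum>r\<in>?I. c r * form w (block_col bs N r 0))"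
    if w: "w \<in> carrier_vec n" for w
  proof -
    have "form w z = (\<Sum>j<n. \<Sum>r\<in>?I. (if j = ?off r then c r * form w (col N j) else 0))"
      unfolding z_def form_mult_mat_vec[OF w N v]
      by (intro sum.cong) (auto simp: v_def sum_distrib_right intro!: sum.cong)
    also have "\<dots> = (\<Sum>r\<in>?I. \<Sum>j<n. (if j = ?off r then c r * form w (col N j) else 0))"
      by (rule sum.swap)
    also have "\<dots> = (\<Sum>r\<in>?I. c r * form w (block_col bs N r 0))"
    proof (intro sum.cong refl)
      fix r assume "r \<in> ?I"
      hence "?off r < n" using off[of r 0] p by auto
      thus "(\<Sum>j<n. (if j = ?off r then c r * form w (col N j) else 0))
          = c r * form w (block_col bs N r 0)"
        by (simp add: block_col_def)
    qed
    finally show ?thesis .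
  qed
  have "z = 0\<^sub>v n"
  proof (rule perpendicular_to_basis[OF Hi N Ni(1,2) z])
    fix j assume "j < n"
    then obtain r a where r: "r < length bs" "a < ?m r" and j: "j = ?off r + a"
      using block_position[of j bs] n by metis
    let ?w = "block_col bs N r a"
    have w: "?w \<in> carrier_vec n" using bc[OF r] .
    have "form ?w z = 0"
    proof (cases "r \<in> ?I \<and> a = ?m r - 1")
      case True
      have "form ?w z = (\<Sum>i\<in>?I. c i * moment l (?x r) (?x i) (?m i - 1))"
        unfolding form_z[OF w]
      proof (intro sum.cong refl)
        fix k assume k: "k \<in> ?I"
        show "c k * form ?w (block_col bs N k 0) = c k * moment l (?x r) (?x k) (?m k - 1)"
          unfolding moment_def soc[OF k] using True by (simp add: generator_def)
      qed
      also have "\<dots> = 0" using bspec[OF c] True by blast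
      finally show ?thesis .
    next
      case False
      have "form ?w (block_col bs N k 0) = 0" if k: "k \<in> ?I" for k
      proof (cases "r \<in> ?I")
        case True
        hence a: "Suc a < ?m r" using False r by auto
        have "?w = (shift A l ^^ 1) (block_col bs N r (Suc a))"
          using sh[of r "Suc a" 1] a r True by simp
        moreover have "(shift A l ^^ 1) (block_col bs N k 0) = 0\<^sub>v n"
          using sh[of k 0 1] k p[of k] by auto
        ultimately show ?thesis
          using shift_selfadjoint[OF l bc[OF r(1) a] bc[of k 0], of 1 0] k p[of k] bc[OF r(1) a]
          by (simp add: moment_def)
      next
        case False
        hence "snd (bs ! r) \<noteq> l" using r by simp
        hence "\<sigma> (snd (bs ! r)) \<noteq> l" using l invol by metis
        thus ?thesis
          by (rule generalized_eigenvectors_orthogonal[where m = "Suc a" and m' = 1])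
            (use sh[of r a "Suc a"] sh[of k 0 1] r k p[of k] bc[of r a] bc[of k 0] in auto)
      qed
      thus ?thesis unfolding form_z[OF w] by simp
    qed
    thus "form (col N j) z = 0" by (simp add: block_col_def j)
  qed
  hence "v = 0\<^sub>v n"
  proof -
    have "v = (Ni * N) *\<^sub>v v" using Ni v by simp
    also have "\<dots> = Ni *\<^sub>v z" unfolding z_def using Ni N v by (intro assoc_mult_mat_vec) auto
    also have "\<dots> = 0\<^sub>v n" unfolding \<open>z = 0\<^sub>v n\<close> using Ni by (intro eq_vecI) auto
    finally show ?thesis .
  qed
  moreover have "?off i < n" using off[of i 0] i p[of i] by auto
  moreover from this have "v $ ?off i = (\<Sum>r\<in>?I. if ?off i = ?off r then c r else 0)"
    unfolding v_def by (rule index_vec)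
  ultimately have "(\<Sum>r\<in>?I. if ?off i = ?off r then c r else 0) = 0" by simp
  moreover have "(\<Sum>r\<in>?I. if ?off i = ?off r then c r else 0) = (\<Sum>r\<in>?I. if i = r then c r else 0)"
  proof (intro sum.cong refl)
    fix r assume "r \<in> ?I"
    with i inj[of i r] have "?off i = ?off r \<longleftrightarrow> i = r" by auto
    thus "(if ?off i = ?off r then c r else 0) = (if i = r then c r else 0)" by simp
  qed
  ultimately show "c i = 0" using i by simp
qed

end

section \<open>Canonical generators for a real pair\<close>

text \<open>
  A chain is identified by the position \<open>r\<close> of its block in the list, since the list may contain the same
  pair of size and eigenvalue several times.
\<close>
definition canonical_generators ::
  "('a :: comm_ring_1 \<Rightarrow> 'a) \<Rightarrow> nat \<Rightarrow> 'a mat \<Rightarrow> 'a mat \<Rightarrow> (nat \<times> 'a) list \<Rightarrow> 'a \<Rightarrow> 'a set \<Rightarrow>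
     (nat \<Rightarrow> 'a vec) \<Rightarrow> (nat \<Rightarrow> 'a) \<Rightarrow> bool" where
  "canonical_generators \<sigma> n H A bs l E y e \<longleftrightarrow> (\<forall>r<length bs. snd (bs ! r) = l \<longrightarrow>
     y r \<in> carrier_vec n \<and> (shift A l ^^ fst (bs ! r)) (y r) = 0\<^sub>v n \<and> e r \<in> E \<and>
     (\<forall>s<length bs. snd (bs ! s) = l \<longrightarrow>
       (\<forall>t. sesq_form \<sigma> H (y r) ((shift A l ^^ t) (y s))
         = (if r = s \<and> t = fst (bs ! r) - 1 then e r else 0))))"

lemma canonical_generatorsD:
  assumes "canonical_generators \<sigma> n H A bs l E y e" "r < length bs" "snd (bs ! r) = l"
  shows "y r \<in> carrier_vec n" "(shift A l ^^ fst (bs ! r)) (y r) = 0\<^sub>v n" "e r \<in> E"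
    and "s < length bs \<Longrightarrow> snd (bs ! s) = l \<Longrightarrow> sesq_form \<sigma> H (y r) ((shift A l ^^ t) (y s))
      = (if r = s \<and> t = fst (bs ! r) - 1 then e r else 0)"
  using assms by (simp_all add: canonical_generators_def)

context selfadjoint_pair
begin

theorem canonical_generators_exist:
  assumes l: "\<sigma> l = l"
    and Hi: "Hi \<in> carrier_mat n n" "H * Hi = 1\<^sub>m n"
    and N: "N \<in> carrier_mat n n" and Ni: "Ni \<in> carrier_mat n n" "N * Ni = 1\<^sub>m n" "Ni * N = 1\<^sub>m n"
    and n: "n = sum_list (map fst bs)"
    and AN: "A * N = N * jordan_matrix bs" and pos: "0 \<notin> fst ` set bs"
    and E: "\<And>a. a \<noteq> 0 \<Longrightarrow> \<sigma> a = a \<Longrightarrow> \<exists>c. \<sigma> c * c * a \<in> E"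
  shows "\<exists>y e. canonical_generators \<sigma> n H A bs l E y e"
proof -
  let ?I = "{r. r < length bs \<and> snd (bs ! r) = l}"
  have fin: "finite ?I" by simp
  show ?thesis
  proof (rule flipped_orthogonal_chains[OF l fin jordan_basis_chains[OF N n AN pos]
        jordan_basis_nondegenerate[OF l Hi N Ni n AN pos], where E = E])
    show "\<exists>c. \<sigma> c * c * a \<in> E" if "a \<noteq> 0" "\<sigma> a = a" for a by (rule E[OF that])
    fix y e
    assume y: "chains l ?I (\<lambda>r. fst (bs ! r)) y" and e: "\<And>i. i \<in> ?I \<Longrightarrow> e i \<in> E"
      and mo: "\<And>i j s. i \<in> ?I \<Longrightarrow> j \<in> ?I \<Longrightarrow>
         moment l (y i) (y j) s = (if i = j \<and> s = fst (bs ! i) - 1 then e i else 0)"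
    have "canonical_generators \<sigma> n H A bs l E y e"
      unfolding canonical_generators_def
    proof (intro allI impI conjI)
      fix r assume r: "r < length bs" "snd (bs ! r) = l"
      show "y r \<in> carrier_vec n" "(shift A l ^^ fst (bs ! r)) (y r) = 0\<^sub>v n" "e r \<in> E"
        using y e[of r] r by (auto simp: chains_def)
      fix s t assume "s < length bs" "snd (bs ! s) = l"
      thus "form (y r) ((shift A l ^^ t) (y s)) = (if r = s \<and> t = fst (bs ! r) - 1 then e r else 0)"
        using mo[of r s t] r by (simp add: moment_def)
    qed
    thus ?thesis by blast
  qed
qed

end

lemma selfadjoint_pair_of_real:
  fixes A H :: "real mat" and \<sigma> :: "complex \<Rightarrow> complex"
  assumes "field_hom \<sigma>" and inv: "\<And>a. \<sigma> (\<sigma> a) = a"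
    and fix_real: "\<And>a. \<sigma> (complex_of_real a) = complex_of_real a"
    and A: "A \<in> carrier_mat n n" and H: "H \<in> carrier_mat n n"
    and sym: "H = transpose_mat H" and sa: "transpose_mat A * H = H * A"
  shows "selfadjoint_pair \<sigma> n (map_mat complex_of_real H) (map_mat complex_of_real A)"
proof -
  interpret field_hom \<sigma> by fact
  have m: "map_mat \<sigma> (map_mat complex_of_real B) = map_mat complex_of_real B" for B
    by (intro eq_matI) (auto simp: fix_real)
  have t: "(map_mat complex_of_real B)\<^sup>T = map_mat complex_of_real (B\<^sup>T)" for B
    by (intro eq_matI) auto
  show ?thesis
  proof
    show "(map_mat \<sigma> (map_mat complex_of_real H))\<^sup>T = map_mat complex_of_real H"
      unfolding m t using sym by simp
    show "(map_mat \<sigma> (map_mat complex_of_real A))\<^sup>T * map_mat complex_of_real H =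
      map_mat complex_of_real H * map_mat complex_of_real A"
      unfolding m t using A H sa of_real_hom.mat_hom_mult[of "A\<^sup>T" n n H n, where ?'a = complex]
        of_real_hom.mat_hom_mult[of H n n A n, where ?'a = complex]
      by simp
  qed (use A H inv in auto)
qed

lemma field_hom_cnj: "field_hom cnj" by unfold_locales auto

lemma field_hom_ident: "field_hom (\<lambda>x :: complex. x)" by unfold_locales auto

text \<open>
  The scaling can only change the absolute value of a real number, hence the sign remains.
\<close>
lemma real_normalization:
  assumes "a \<noteq> 0" "cnj a = a"
  shows "\<exists>c. cnj c * c * a \<in> {1, -1}"
proof -
  have ra: "a = complex_of_real (Re a)" using assms(2) by (simp add: complex_eq_iff)
  hence r0: "Re a \<noteq> 0" using assms(1) by (metis of_real_0)
  define x where "x = 1 / sqrt \<bar>Re a\<bar>"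
  have "x * x * Re a = Re a / \<bar>Re a\<bar>" by (simp add: x_def)
  also have "\<dots> \<in> {1, -1}" using r0 by (cases "Re a < 0") auto
  finally have "x * x * Re a \<in> {1, -1}" .
  hence "complex_of_real (x * x * Re a) \<in> {1, -1}"
    by (metis insert_iff of_real_1 of_real_minus singletonD)
  moreover have "cnj (complex_of_real x) * complex_of_real x * a = complex_of_real (x * x * Re a)"
    by (subst ra) simp
  ultimately show ?thesis by metis
qed

lemma i_normalization:
  fixes a :: complex
  assumes "a \<noteq> 0"
  shows "\<exists>c. c * c * a \<in> {\<i>}"
proof -
  have "csqrt (\<i> / a) * csqrt (\<i> / a) = \<i> / a" by (metis power2_csqrt power2_eq_square)
  thus ?thesis using assms by (intro exI[of _ "csqrt (\<i> / a)"]) simp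
qed

text \<open>
  The chains for different eigenvalues are chosen independently of each other, each with the form
  whose automorphism fixes the eigenvalue.
\<close>
lemma canonical_jordan_chains_real:
  fixes A H :: "real mat"
  defines "AC \<equiv> map_mat complex_of_real A" and "HC \<equiv> map_mat complex_of_real H"
  assumes A: "A \<in> carrier_mat n n" and H: "H \<in> carrier_mat n n" and inv: "invertible_mat H"
    and sym: "H = transpose_mat H" and sa: "transpose_mat A * H = H * A"
    and jnf: "jordan_nf AC bs"
  obtains y e where
    "\<And>r. r < length bs \<Longrightarrow> y r \<in> carrier_vec n"
    "\<And>r. r < length bs \<Longrightarrow> (shift AC (snd (bs ! r)) ^^ fst (bs ! r)) (y r) = 0\<^sub>v n"
    "\<And>r. r < length bs \<Longrightarrow> snd (bs ! r) \<in> \<real> \<Longrightarrow> e r \<in> {1, -1}"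
    "\<And>r s t. r < length bs \<Longrightarrow> s < length bs \<Longrightarrow> snd (bs ! s) = snd (bs ! r) \<Longrightarrow> snd (bs ! r) \<in> \<real> \<Longrightarrow>
       sesq_form cnj HC (y r) ((shift AC (snd (bs ! r)) ^^ t) (y s))
         = (if r = s \<and> t = fst (bs ! r) - 1 then e r else 0)"
    "\<And>r s t. r < length bs \<Longrightarrow> s < length bs \<Longrightarrow> snd (bs ! s) = snd (bs ! r) \<Longrightarrow> snd (bs ! r) \<notin> \<real> \<Longrightarrow>
       sesq_form (\<lambda>x. x) HC (y r) ((shift AC (snd (bs ! r)) ^^ t) (y s))
         = (if r = s \<and> t = fst (bs ! r) - 1 then \<i> else 0)"
proof -
  have C: "selfadjoint_pair cnj n HC AC"
    unfolding AC_def HC_def by (rule selfadjoint_pair_of_real[OF field_hom_cnj _ _ A H sym sa]) auto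
  have B: "selfadjoint_pair (\<lambda>x. x) n HC AC"
    unfolding AC_def HC_def by (rule selfadjoint_pair_of_real[OF field_hom_ident _ _ A H sym sa]) auto
  from inv obtain Hi where "inverts_mat H Hi" "inverts_mat Hi H"
    unfolding invertible_mat_def by blast
  hence Hi: "Hi \<in> carrier_mat n n" "H * Hi = 1\<^sub>m n"
    using H unfolding inverts_mat_def
    by (metis carrier_matD carrier_matI index_mult_mat(3) index_one_mat(3) mult_carrier_mat)+
  define HI where "HI = map_mat complex_of_real Hi"
  have HI: "HI \<in> carrier_mat n n" "HC * HI = 1\<^sub>m n"
    using Hi H of_real_hom.mat_hom_mult[OF H Hi(1), where ?'a = complex]
    by (simp_all add: HI_def HC_def of_real_hom.mat_hom_one[where ?'a = complex])
  from jnf have pos: "0 \<notin> fst ` set bs" and "similar_mat AC (jordan_matrix bs)"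
    by (auto simp: jordan_nf_def)
  then obtain N Ni where w: "similar_mat_wit AC (jordan_matrix bs) N Ni"
    unfolding similar_mat_def by blast
  from similar_mat_witD2[OF selfadjoint_pair.A[OF C] w] have N: "N \<in> carrier_mat n n" and
    Ni: "Ni \<in> carrier_mat n n" "N * Ni = 1\<^sub>m n" "Ni * N = 1\<^sub>m n"
    and J: "jordan_matrix bs \<in> carrier_mat n n" and AC: "AC = N * jordan_matrix bs * Ni" by auto
  have n: "n = sum_list (map fst bs)" using J by auto
  have "AC * N = N * jordan_matrix bs * (Ni * N)"
    unfolding AC by (rule assoc_mult_mat[OF mult_carrier_mat[OF N J] Ni(1) N])
  also have "\<dots> = N * jordan_matrix bs"
    unfolding Ni(3) by (rule right_mult_one_mat[OF mult_carrier_mat[OF N J]])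
  finally have AN: "AC * N = N * jordan_matrix bs" .
  have "\<exists>y e. (l \<in> \<real> \<longrightarrow> canonical_generators cnj n HC AC bs l {1, -1} y e) \<and>
      (l \<notin> \<real> \<longrightarrow> canonical_generators (\<lambda>x. x) n HC AC bs l {\<i>} y e)" for l
  proof (cases "l \<in> \<real>")
    case True
    hence "cnj l = l" by (rule Reals_cnj_iff[THEN iffD1])
    have "\<exists>y e. canonical_generators cnj n HC AC bs l {1, -1} y e"
      by (rule selfadjoint_pair.canonical_generators_exist[OF C \<open>cnj l = l\<close> HI N Ni n AN pos]) (rule real_normalization)
    thus ?thesis using True by metis
  next
    case False
    have "\<exists>y e. canonical_generators (\<lambda>x. x) n HC AC bs l {\<i>} y e"
      by (rule selfadjoint_pair.canonical_generators_exist[OF B refl HI N Ni n AN pos]) (rule i_normalization)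
    thus ?thesis using False by metis
  qed
  hence "\<forall>l. \<exists>y e. (l \<in> \<real> \<longrightarrow> canonical_generators cnj n HC AC bs l {1, -1} y e) \<and>
      (l \<notin> \<real> \<longrightarrow> canonical_generators (\<lambda>x. x) n HC AC bs l {\<i>} y e)"
    by blast
  from choice[OF this] obtain Y where
    "\<forall>l. \<exists>e. (l \<in> \<real> \<longrightarrow> canonical_generators cnj n HC AC bs l {1, -1} (Y l) e) \<and>
      (l \<notin> \<real> \<longrightarrow> canonical_generators (\<lambda>x. x) n HC AC bs l {\<i>} (Y l) e)" ..
  from choice[OF this] obtain E where
    E: "\<And>l. l \<in> \<real> \<Longrightarrow> canonical_generators cnj n HC AC bs l {1, -1} (Y l) (E l)"
       "\<And>l. l \<notin> \<real> \<Longrightarrow> canonical_generators (\<lambda>x. x) n HC AC bs l {\<i>} (Y l) (E l)" by blast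
  show thesis
  proof (rule that[of "\<lambda>r. Y (snd (bs ! r)) r" "\<lambda>r. E (snd (bs ! r)) r"])
    fix r assume r: "r < length bs"
    let ?l = "snd (bs ! r)"
    show "Y ?l r \<in> carrier_vec n"
      using canonical_generatorsD(1)[OF E(1) r refl] canonical_generatorsD(1)[OF E(2) r refl] by metis
    show "(shift AC ?l ^^ fst (bs ! r)) (Y ?l r) = 0\<^sub>v n"
      using canonical_generatorsD(2)[OF E(1) r refl] canonical_generatorsD(2)[OF E(2) r refl] by metis
    show "E ?l r \<in> {1, -1}" if "?l \<in> \<real>"
      using canonical_generatorsD(3)[OF E(1)[OF that] r refl] .
    fix s t assume s: "s < length bs" "snd (bs ! s) = ?l"
    show "sesq_form cnj HC (Y ?l r) ((shift AC ?l ^^ t) (Y (snd (bs ! s)) s))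
         = (if r = s \<and> t = fst (bs ! r) - 1 then E ?l r else 0)" if "?l \<in> \<real>"
      unfolding s(2) by (rule canonical_generatorsD(4)[OF E(1)[OF that] r refl s])
    show "sesq_form (\<lambda>x. x) HC (Y ?l r) ((shift AC ?l ^^ t) (Y (snd (bs ! s)) s))
         = (if r = s \<and> t = fst (bs ! r) - 1 then \<i> else 0)" if nr: "?l \<notin> \<real>"
    proof -
      have "E ?l r = \<i>" using canonical_generatorsD(3)[OF E(2)[OF nr] r refl] by simp
      from canonical_generatorsD(4)[OF E(2)[OF nr] r refl s, of t, unfolded this] show ?thesis
        unfolding s(2) .
    qed
  qed
qed

section \<open>Gram matrices of partitioned matrices\<close>

definition gram :: "complex mat \<Rightarrow> complex mat \<Rightarrow> complex mat \<Rightarrow> complex mat" where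
  "gram H X Y = mat_adjoint X * H * Y"

lemma mat_adjoint_eq: "mat_adjoint X = (map_mat conjugate X)\<^sup>T"
  unfolding mat_adjoint_def by (intro eq_matI) (auto simp: mat_of_rows_def)

lemma dim_gram [simp]: "dim_row (gram H X Y) = dim_col X" "dim_col (gram H X Y) = dim_col Y"
  by (simp_all add: gram_def mat_adjoint_eq)

lemma gram_index:
  assumes H: "H \<in> carrier_mat n n" and X: "X \<in> carrier_mat n k" and Y: "Y \<in> carrier_mat n m"
    and i: "i < k" and j: "j < m"
  shows "gram H X Y $$ (i, j) = sesq_form cnj H (col X i) (col Y j)"
proof -
  have a: "mat_adjoint X \<in> carrier_mat k n" using X by (simp add: mat_adjoint_eq)
  have "gram H X Y = mat_adjoint X * (H * Y)"
    unfolding gram_def using a H Y by (rule assoc_mult_mat)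
  hence "gram H X Y $$ (i, j) = row (mat_adjoint X) i \<bullet> col (H * Y) j"
    using a H Y i j by simp
  also have "row (mat_adjoint X) i = map_vec cnj (col X i)"
    using X i by (intro eq_vecI) (auto simp: mat_adjoint_eq)
  also have "col (H * Y) j = H *\<^sub>v col Y j" using H Y j by (rule col_mult2)
  finally show ?thesis by (simp add: sesq_form_def)
qed

lemma hconcat_mat_Cons:
  assumes M: "M \<in> carrier_mat n k" and Ms: "\<forall>M\<in>set Ms. dim_row M = n"
  shows "hconcat_mat n (M # Ms)
    = four_block_mat M (hconcat_mat n Ms) (0\<^sub>m 0 k) (0\<^sub>m 0 (dim_col (hconcat_mat n Ms)))"
    (is "?l = ?r")
proof (rule eq_matI)
  let ?cs = "concat (map cols Ms)"
  fix i j assume "i < dim_row ?r" "j < dim_col ?r"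
  hence i: "i < n" and j: "j < k + length ?cs" using M by (auto simp: hconcat_mat_def)
  have "?l $$ (i, j) = (cols M @ ?cs) ! j $ i"
    unfolding hconcat_mat_def using i j M by (subst mat_of_cols_index) auto
  thus "?l $$ (i, j) = ?r $$ (i, j)"
    using i j M by (auto simp: hconcat_mat_def mat_of_cols_index nth_append)
qed (use M in \<open>auto simp: hconcat_mat_def\<close>)

lemma hconcat_mat_dims [simp]:
  "dim_row (hconcat_mat n Ms) = n"
  "dim_col (hconcat_mat n Ms) = sum_list (map dim_col Ms)"
  by (simp_all add: hconcat_mat_def length_concat comp_def)

lemma col_hconcat_mat_Cons:
  fixes M :: "'a :: zero mat"
  assumes M: "M \<in> carrier_mat n k" and Ms: "\<forall>M\<in>set Ms. dim_row M = n"
    and j: "j < k + sum_list (map dim_col Ms)"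
  shows "col (hconcat_mat n (M # Ms)) j = (if j < k then col M j else col (hconcat_mat n Ms) (j - k))"
  unfolding hconcat_mat_Cons[OF M Ms]
  using M j by (intro eq_vecI) (auto simp: )

lemma mult_hconcat_mat:
  assumes A: "A \<in> carrier_mat n n"
    and "list_all2 (\<lambda>M B. \<exists>k. M \<in> carrier_mat n k \<and> B \<in> carrier_mat k k \<and> A * M = M * B) Ms Bs"
  shows "A * hconcat_mat n Ms = hconcat_mat n Ms * diag_block_mat Bs"
  using assms(2)
proof (induction rule: list_all2_induct)
  case Nil
  thus ?case using A by (intro eq_matI) auto
next
  case (Cons M Ms B Bs)
  then obtain k where M: "M \<in> carrier_mat n k" and B: "B \<in> carrier_mat k k" and AM: "A * M = M * B"
    by auto
  define R where "R = hconcat_mat n Ms"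
  define D where "D = diag_block_mat Bs"
  define c where "c = sum_list (map dim_col Ms)"
  have rows: "\<forall>M\<in>set Ms. dim_row M = n"
    using Cons.hyps(2) by (auto simp: list_all2_conv_all_nth in_set_conv_nth) (metis carrier_matD(1))
  have eqs: "map dim_row Bs = map dim_col Ms" "map dim_col Bs = map dim_col Ms"
    using Cons.hyps(2) by (auto simp: list_all2_conv_all_nth intro!: nth_equalityI)
  have R: "R \<in> carrier_mat n c" by (auto simp: R_def c_def)
  have D: "D \<in> carrier_mat c c" using eqs by (auto simp: D_def c_def dim_diag_block_mat)
  have z: "0\<^sub>m 0 k \<in> carrier_mat 0 k" "0\<^sub>m 0 c \<in> carrier_mat 0 c" "0\<^sub>m n 0 \<in> carrier_mat n 0"
    "0\<^sub>m 0 n \<in> carrier_mat 0 n" "0\<^sub>m 0 0 \<in> carrier_mat 0 0" "0\<^sub>m k c \<in> carrier_mat k c"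
    "0\<^sub>m c k \<in> carrier_mat c k" by auto
  have hc: "hconcat_mat n (M # Ms) = four_block_mat M R (0\<^sub>m 0 k) (0\<^sub>m 0 c)"
    unfolding hconcat_mat_Cons[OF M rows] by (simp add: R_def c_def)
  have A': "A = four_block_mat A (0\<^sub>m n 0) (0\<^sub>m 0 n) (0\<^sub>m 0 0)"
    using A by (intro eq_matI) auto
  have "A * hconcat_mat n (M # Ms) = four_block_mat (A * M) (A * R) (0\<^sub>m 0 k) (0\<^sub>m 0 c)"
    unfolding hc by (subst A', subst mult_four_block_mat[OF A z(3,4,5) M R z(1,2)])
      (use A M R in \<open>auto intro!: eq_matI\<close>)
  also have "\<dots> = four_block_mat (M * B) (R * D) (0\<^sub>m 0 k) (0\<^sub>m 0 c)"
    using AM Cons.IH by (simp add: R_def D_def)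
  also have "\<dots> = four_block_mat M R (0\<^sub>m 0 k) (0\<^sub>m 0 c) * four_block_mat B (0\<^sub>m k c) (0\<^sub>m c k) D"
    by (subst mult_four_block_mat[OF M R z(1,2) B z(6,7) D]) (use B M R D in \<open>auto intro!: cong_four_block_mat\<close>)
  also have "four_block_mat B (0\<^sub>m k c) (0\<^sub>m c k) D = diag_block_mat (B # Bs)"
    using B D by (simp add: D_def[symmetric])
  finally show ?case unfolding hc .
qed

lemma gram_hconcat_zero:
  assumes H: "H \<in> carrier_mat n n" and X: "X \<in> carrier_mat n k"
    and "\<And>M. M \<in> set Ms \<Longrightarrow> dim_row M = n \<and> gram H X M = 0\<^sub>m k (dim_col M)"
  shows "gram H X (hconcat_mat n Ms) = 0\<^sub>m k (sum_list (map dim_col Ms))"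
  using assms(3)
proof (induction Ms)
  case Nil
  thus ?case using X by (intro eq_matI) auto
next
  case (Cons M Ms)
  have M: "M \<in> carrier_mat n (dim_col M)" using Cons.prems by auto
  have R: "hconcat_mat n Ms \<in> carrier_mat n (sum_list (map dim_col Ms))" by auto
  have L: "hconcat_mat n (M # Ms) \<in> carrier_mat n (dim_col M + sum_list (map dim_col Ms))"
    by auto
  have rows: "\<forall>M\<in>set Ms. dim_row M = n" using Cons.prems by auto
  show ?case
  proof (rule eq_matI)
    fix i j assume "i < dim_row (0\<^sub>m k (sum_list (map dim_col (M # Ms))) :: complex mat)"
      "j < dim_col (0\<^sub>m k (sum_list (map dim_col (M # Ms))) :: complex mat)"
    hence i: "i < k" and j: "j < dim_col M + sum_list (map dim_col Ms)" by auto
    have "gram H X (hconcat_mat n (M # Ms)) $$ (i, j) = 0"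
    proof (cases "j < dim_col M")
      case True
      thus ?thesis using gram_index[OF H X L i j] gram_index[OF H X M i True] Cons.prems[of M] i j
        by (simp add: col_hconcat_mat_Cons[OF M rows])
    next
      case False
      hence j': "j - dim_col M < sum_list (map dim_col Ms)" using j by auto
      have "gram H X (hconcat_mat n Ms) = 0\<^sub>m k (sum_list (map dim_col Ms))"
        using Cons by auto
      thus ?thesis using gram_index[OF H X L i j] gram_index[OF H X R i j'] Cons.prems i j j' False
        by (simp add: col_hconcat_mat_Cons[OF M rows])
    qed
    thus "gram H X (hconcat_mat n (M # Ms)) $$ (i, j)
      = 0\<^sub>m k (sum_list (map dim_col (M # Ms))) $$ (i, j)" using i j by simp
  qed (use X in auto)
qed

lemma gram_hconcat_Cons:
  assumes H: "H \<in> carrier_mat n n" and M: "M \<in> carrier_mat n k"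
    and Ms: "\<forall>M\<in>set Ms. dim_row M = n"
  shows "gram H (hconcat_mat n (M # Ms)) (hconcat_mat n (M # Ms))
    = four_block_mat (gram H M M) (gram H M (hconcat_mat n Ms))
        (gram H (hconcat_mat n Ms) M) (gram H (hconcat_mat n Ms) (hconcat_mat n Ms))"
proof -
  define c where "c = sum_list (map dim_col Ms)"
  define R where "R = hconcat_mat n Ms"
  have R: "R \<in> carrier_mat n c" by (auto simp: R_def c_def)
  have L: "hconcat_mat n (M # Ms) \<in> carrier_mat n (k + c)" using M by (auto simp: c_def)
  have cl: "col (hconcat_mat n (M # Ms)) j = (if j < k then col M j else col R (j - k))"
    if "j < k + c" for j
    using col_hconcat_mat_Cons[OF M Ms] that by (simp add: c_def R_def)
  show ?thesis unfolding R_def[symmetric]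
  proof (rule eq_matI)
    fix i j
    assume "i < dim_row (four_block_mat (gram H M M) (gram H M R) (gram H R M) (gram H R R))"
      "j < dim_col (four_block_mat (gram H M M) (gram H M R) (gram H R M) (gram H R R))"
    hence i: "i < k + c" and j: "j < k + c" using M R by auto
    show "gram H (hconcat_mat n (M # Ms)) (hconcat_mat n (M # Ms)) $$ (i, j)
      = four_block_mat (gram H M M) (gram H M R) (gram H R M) (gram H R R) $$ (i, j)"
      using i j M R unfolding gram_index[OF H L L i j]
      by (auto simp: cl gram_index[OF H M M] gram_index[OF H M R] gram_index[OF H R M] gram_index[OF H R R])
  qed (use M R L in auto)
qed

section \<open>Matrices of chains and their conjugates\<close>

lemma hconcat_mat_singleton [simp]: "M \<in> carrier_mat n k \<Longrightarrow> hconcat_mat n [M] = M"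
  by (auto simp: hconcat_mat_def)

lemma gram_zero_swap:
  assumes sp: "selfadjoint_pair cnj n H A"
    and X: "X \<in> carrier_mat n k" and Y: "Y \<in> carrier_mat n m"
    and z: "gram H X Y = 0\<^sub>m k m"
  shows "gram H Y X = 0\<^sub>m m k"
proof (rule eq_matI)
  interpret selfadjoint_pair cnj n H A by fact
  fix i j assume "i < dim_row (0\<^sub>m m k :: complex mat)" "j < dim_col (0\<^sub>m m k :: complex mat)"
  hence i: "i < m" and j: "j < k" by auto
  have "gram H Y X $$ (i, j) = cnj (gram H X Y $$ (j, i))"
    unfolding gram_index[OF selfadjoint_pair.H[OF sp] Y X i j] gram_index[OF selfadjoint_pair.H[OF sp] X Y j i]
    by (rule form_hermitian) (use X Y i j in auto)
  thus "gram H Y X $$ (i, j) = 0\<^sub>m m k $$ (i, j)" using z i j by simp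
qed (use X Y in auto)

lemma gram_hconcat_orthogonal:
  assumes H: "selfadjoint_pair cnj n H A"
    and "distinct ks" and "\<And>k. k \<in> set ks \<Longrightarrow> M k \<in> carrier_mat n (d k)"
    and "\<And>k l. k \<in> set ks \<Longrightarrow> l \<in> set ks \<Longrightarrow> k \<noteq> l \<Longrightarrow> gram H (M k) (M l) = 0\<^sub>m (d k) (d l)"
  shows "gram H (hconcat_mat n (map M ks)) (hconcat_mat n (map M ks))
    = diag_block_mat (map (\<lambda>k. gram H (M k) (M k)) ks)"
  using assms(2-)
proof (induction ks)
  case Nil
  thus ?case by (intro eq_matI) auto
next
  case (Cons k ks)
  note HC = selfadjoint_pair.H[OF H]
  define R where "R = hconcat_mat n (map M ks)"
  define c where "c = sum_list (map dim_col (map M ks))"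
  have M: "M k \<in> carrier_mat n (d k)" using Cons.prems(2)[of k] by simp
  have R: "R \<in> carrier_mat n c" by (auto simp: R_def c_def)
  have rows: "\<forall>X\<in>set (map M ks). dim_row X = n" using Cons.prems(2) by fastforce
  have z: "gram H (M k) R = 0\<^sub>m (d k) c"
    unfolding R_def c_def
  proof (rule gram_hconcat_zero[OF HC M])
    fix X assume "X \<in> set (map M ks)"
    then obtain l where l: "l \<in> set ks" "X = M l" by auto
    hence "l \<noteq> k" using Cons.prems(1) by auto
    thus "dim_row X = n \<and> gram H (M k) X = 0\<^sub>m (d k) (dim_col X)"
      using Cons.prems(2)[of l] Cons.prems(3)[of k l] l by auto
  qed
  have IH: "gram H R R = diag_block_mat (map (\<lambda>k. gram H (M k) (M k)) ks)"
    unfolding R_def using Cons.prems by (intro Cons.IH) auto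
  have "gram H (hconcat_mat n (M k # map M ks)) (hconcat_mat n (M k # map M ks))
      = four_block_mat (gram H (M k) (M k)) (0\<^sub>m (d k) c) (0\<^sub>m c (d k)) (gram H R R)"
    unfolding gram_hconcat_Cons[OF HC M rows] R_def[symmetric] z gram_zero_swap[OF H M R z] ..
  thus ?case using M R by (simp add: IH[symmetric])
qed

lemma sip_mat_carrier [simp]: "sip_mat m \<in> carrier_mat m m"
  by (simp add: sip_mat_def)

lemma sip_mat_square: "sip_mat m * sip_mat m = (1\<^sub>m m :: 'a :: semiring_1 mat)"
proof (rule eq_matI)
  fix i j assume "i < dim_row (1\<^sub>m m :: 'a mat)" "j < dim_col (1\<^sub>m m :: 'a mat)"
  hence i: "i < m" and j: "j < m" by auto
  have "(sip_mat m * sip_mat m) $$ (i, j)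
      = (\<Sum>k = 0..<m. (if i + k + 1 = m then 1 else 0) * (if k + j + 1 = m then 1 else 0 :: 'a))"
    using i j by (simp add: sip_mat_def scalar_prod_def)
  also have "\<dots> = (\<Sum>k = 0..<m. (if k = m - 1 - i then (if k + j + 1 = m then 1 else 0) else 0))"
    using i j by (intro sum.cong) auto
  also have "\<dots> = 1\<^sub>m m $$ (i, j)" using i j by auto
  finally show "(sip_mat m * sip_mat m) $$ (i, j) = (1\<^sub>m m :: 'a mat) $$ (i, j)" .
qed (auto simp: sip_mat_def)

lemma sip_mat_double:
  "four_block_mat (0\<^sub>m m m) (sip_mat m) (sip_mat m) (0\<^sub>m m m) = sip_mat (2 * m)"
  by (intro eq_matI) (auto simp: sip_mat_def)

lemma smult_mat_square:
  fixes M :: "'a :: comm_ring_1 mat"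
  assumes M: "M \<in> carrier_mat m m"
  shows "(c \<cdot>\<^sub>m M) * (c \<cdot>\<^sub>m M) = (c * c) \<cdot>\<^sub>m (M * M)"
proof -
  have "(c \<cdot>\<^sub>m M) * (c \<cdot>\<^sub>m M) = c \<cdot>\<^sub>m (M * (c \<cdot>\<^sub>m M))"
    by (rule mult_smult_assoc_mat[OF M smult_carrier_mat[OF M]])
  also have "M * (c \<cdot>\<^sub>m M) = c \<cdot>\<^sub>m (M * M)"
    by (rule mult_smult_distrib[OF M M])
  also have "c \<cdot>\<^sub>m (c \<cdot>\<^sub>m (M * M)) = (c * c) \<cdot>\<^sub>m (M * M)"
    using M by (intro eq_matI) (auto simp: mult.assoc)
  finally show ?thesis .
qed

lemma diag_block_mat_involutions:
  fixes Ps :: "'a :: semiring_1 mat list"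
  assumes "\<And>P. P \<in> set Ps \<Longrightarrow> square_mat P \<and> P * P = 1\<^sub>m (dim_row P)"
  shows "diag_block_mat Ps * diag_block_mat Ps = 1\<^sub>m (dim_row (diag_block_mat Ps))"
proof -
  have two: "P ^\<^sub>m Suc (Suc 0) = P * P" if "square_mat P" for P :: "'a mat"
    using that by simp
  have sq: "square_mat (diag_block_mat Ps)" using assms by (intro diag_block_mat_square) auto
  have "diag_block_mat Ps ^\<^sub>m Suc (Suc 0) = diag_block_mat (map (\<lambda>P. P ^\<^sub>m Suc (Suc 0)) Ps)"
    using assms by (intro diag_block_pow_mat) auto
  also have "map (\<lambda>P. P ^\<^sub>m Suc (Suc 0)) Ps = map (\<lambda>P. 1\<^sub>m (dim_row P)) Ps"
    using assms two by (intro map_cong) auto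
  also have "diag_block_mat \<dots> = 1\<^sub>m (dim_row (diag_block_mat Ps))"
    by (simp add: dim_diag_block_mat)
  finally show ?thesis unfolding two[OF sq] .
qed

text \<open>
  The generator is the last column, in accordance with ones on the superdiagonal of a Jordan block.
\<close>
definition chain_mat :: "nat \<Rightarrow> complex mat \<Rightarrow> complex \<Rightarrow> nat \<Rightarrow> complex vec \<Rightarrow> complex mat" where
  "chain_mat n A l m y = mat_of_cols n (map (\<lambda>j. (shift A l ^^ (m - 1 - j)) y) [0..<m])"

lemma chain_mat_carrier [simp]: "chain_mat n A l m y \<in> carrier_mat n m"
  by (simp add: chain_mat_def carrier_matI)

lemma chain_mat_dims [simp]:
  "dim_row (chain_mat n A l m y) = n" "dim_col (chain_mat n A l m y) = m"
  by (simp_all add: chain_mat_def)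

lemma col_chain_mat:
  assumes "A \<in> carrier_mat n n" "y \<in> carrier_vec n" "j < m"
  shows "col (chain_mat n A l m y) j = (shift A l ^^ (m - 1 - j)) y"
  unfolding chain_mat_def using assms shift_carrier[OF assms(1,2)]
  by (subst col_mat_of_cols) auto

lemma mult_chain_mat:
  assumes A: "A \<in> carrier_mat n n" and y: "y \<in> carrier_vec n" and ny: "(shift A l ^^ m) y = 0\<^sub>v n"
  shows "A * chain_mat n A l m y = chain_mat n A l m y * jordan_block m l"
proof -
  define C where "C = chain_mat n A l m y"
  have C: "C \<in> carrier_mat n m" by (simp add: C_def)
  have cc: "col C j = (shift A l ^^ (m - 1 - j)) y" if "j < m" for j
    unfolding C_def by (rule col_chain_mat[OF A y that])
  have "A * C = C * jordan_block m l"
  proof (rule eq_matI)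
    fix i j assume "i < dim_row (C * jordan_block m l)" "j < dim_col (C * jordan_block m l)"
    hence i: "i < n" and j: "j < m" using C by auto
    have sh: "shift A l (col C j) = (if j = 0 then 0\<^sub>v n else col C (j - 1))"
    proof (cases "j = 0")
      case True
      have "shift A l (col C j) = (shift A l ^^ Suc (m - 1 - j)) y" using cc[OF j] by simp
      thus ?thesis using True j ny by simp
    next
      case False
      hence "m - 1 - (j - 1) = Suc (m - 1 - j)" "j - 1 < m" using j by auto
      thus ?thesis using cc[OF j] cc[of "j - 1"] False by simp
    qed
    have "(A * C) $$ (i, j) = (A *\<^sub>v col C j) $ i" using A C i j by simp
    also have "\<dots> = (shift A l (col C j)) $ i + l * C $$ (i, j)"
      using A C i j by (simp add: shift_def)
    also have "\<dots> = (if j = 0 then 0 else C $$ (i, j - 1)) + l * C $$ (i, j)"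
      unfolding sh using C i j by simp
    also have "\<dots> = (\<Sum>k = 0..<m. (if k = j then l * C $$ (i, j) else 0)
        + (if Suc k = j then C $$ (i, j - 1) else 0))"
    proof -
      have "(\<Sum>k = 0..<m. if Suc k = j then C $$ (i, j - 1) else 0)
          = (\<Sum>k = 0..<m. if k = j - 1 then (if j = 0 then 0 else C $$ (i, j - 1)) else 0)"
        by (intro sum.cong) auto
      also have "\<dots> = (if j = 0 then 0 else C $$ (i, j - 1))" using j by simp
      finally show ?thesis using j by (simp add: sum.distrib)
    qed
    also have "\<dots> = (\<Sum>k = 0..<m. C $$ (i, k) * jordan_block m l $$ (k, j))"
      using j by (intro sum.cong) auto
    also have "\<dots> = (C * jordan_block m l) $$ (i, j)"
      using C i j by (simp add: scalar_prod_def)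
    finally show "(A * C) $$ (i, j) = (C * jordan_block m l) $$ (i, j)" .
  qed (use A C in auto)
  thus ?thesis by (simp add: C_def)
qed

text \<open>
  The antilinear involution that maps \<open>Q\<close> to its partner in an \<open>\<i>\<close>-conjugate symmetric pair.
\<close>
definition twist :: "complex mat \<Rightarrow> complex mat" where
  "twist X = \<i> \<cdot>\<^sub>m map_mat cnj X"

lemma twist_dims [simp]: "dim_row (twist X) = dim_row X" "dim_col (twist X) = dim_col X"
  by (simp_all add: twist_def)

lemma twist_carrier [simp]: "twist X \<in> carrier_mat n k \<longleftrightarrow> X \<in> carrier_mat n k"
  by (metis carrier_matD carrier_matI twist_dims)

lemma twist_index: "i < dim_row X \<Longrightarrow> j < dim_col X \<Longrightarrow> twist X $$ (i, j) = \<i> * cnj (X $$ (i, j))"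
  by (simp add: twist_def)

lemma twist_twist [simp]: "twist (twist X) = X"
proof (rule eq_matI)
  have inv: "\<i> * cnj (\<i> * cnj z) = z" for z
    by (simp add: complex_eq_iff)
  fix i j assume "i < dim_row X" "j < dim_col X"
  thus "twist (twist X) $$ (i, j) = X $$ (i, j)"
    by (simp add: twist_index inv del: complex_cnj_mult)
qed simp_all

lemma mult_twist:
  fixes A :: "real mat"
  assumes A: "A \<in> carrier_mat n n" and X: "X \<in> carrier_mat n k"
    and AX: "map_mat complex_of_real A * X = X * jordan_block k l"
  shows "map_mat complex_of_real A * twist X = twist X * jordan_block k (cnj l)"
proof -
  let ?A = "map_mat complex_of_real A"
  interpret cnj: field_hom cnj by (rule field_hom_cnj)
  have A': "?A \<in> carrier_mat n n" using A by simp
  have real: "map_mat cnj ?A = ?A" by (intro eq_matI) auto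
  have J: "map_mat cnj (jordan_block k l) = jordan_block k (cnj l)" by (intro eq_matI) auto
  have "?A * twist X = \<i> \<cdot>\<^sub>m (?A * map_mat cnj X)"
    unfolding twist_def using A' X by (intro mult_smult_distrib) auto
  also have "?A * map_mat cnj X = map_mat cnj (?A * X)"
    using cnj.mat_hom_mult[OF A' X] by (simp only: real)
  also have "\<dots> = map_mat cnj X * jordan_block k (cnj l)"
    unfolding AX using cnj.mat_hom_mult[OF X jordan_block_carrier] by (simp only: J)
  also have "\<i> \<cdot>\<^sub>m \<dots> = twist X * jordan_block k (cnj l)"
    unfolding twist_def using X by (intro mult_smult_assoc_mat[symmetric]) auto
  finally show ?thesis .
qed

text \<open>
  This is where the hermitian form between a vector and a twisted vector becomes the bilinear form.
\<close>
lemma sesq_form_twist_right: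
  fixes H :: "real mat"
  assumes H: "H \<in> carrier_mat n n" and x: "x \<in> carrier_vec n" and y: "y \<in> carrier_vec n"
  shows "sesq_form cnj (map_mat complex_of_real H) x (\<i> \<cdot>\<^sub>v map_vec cnj y)
    = \<i> * cnj (sesq_form (\<lambda>x. x) (map_mat complex_of_real H) x y)"
  using H x y
  by (simp add: sesq_form_def scalar_prod_def sum_distrib_left mult.left_commute)

lemma sesq_form_twist_both:
  fixes H :: "real mat"
  assumes H: "H \<in> carrier_mat n n" and x: "x \<in> carrier_vec n" and y: "y \<in> carrier_vec n"
  shows "sesq_form cnj (map_mat complex_of_real H) (\<i> \<cdot>\<^sub>v map_vec cnj x) (\<i> \<cdot>\<^sub>v map_vec cnj y)
    = cnj (sesq_form cnj (map_mat complex_of_real H) x y)"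
proof -
  let ?H = "map_mat complex_of_real H"
  have "sesq_form (\<lambda>x. x) ?H (\<i> \<cdot>\<^sub>v map_vec cnj x) y = \<i> * sesq_form cnj ?H x y"
  proof -
    have id: "map_vec (\<lambda>x. x) (\<i> \<cdot>\<^sub>v map_vec cnj x) = \<i> \<cdot>\<^sub>v map_vec cnj x" by (intro eq_vecI) auto
    have "(\<i> \<cdot>\<^sub>v map_vec cnj x) \<bullet> (?H *\<^sub>v y) = \<i> * (map_vec cnj x \<bullet> (?H *\<^sub>v y))"
      using H x y by (intro smult_scalar_prod_distrib[of _ n]) auto
    thus ?thesis unfolding sesq_form_def id .
  qed
  hence "sesq_form cnj ?H (\<i> \<cdot>\<^sub>v map_vec cnj x) (\<i> \<cdot>\<^sub>v map_vec cnj y)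
      = \<i> * cnj (\<i> * sesq_form cnj ?H x y)"
    using x by (subst sesq_form_twist_right[OF H _ y]) auto
  thus ?thesis by simp
qed

lemma col_twist: "j < dim_col X \<Longrightarrow> col (twist X) j = \<i> \<cdot>\<^sub>v map_vec cnj (col X j)"
  by (intro eq_vecI) (simp_all add: twist_index)

lemma gram_twist_twist:
  fixes H :: "real mat"
  assumes H: "H \<in> carrier_mat n n" and X: "X \<in> carrier_mat n k" and Y: "Y \<in> carrier_mat n m"
  shows "gram (map_mat complex_of_real H) (twist X) (twist Y)
    = map_mat cnj (gram (map_mat complex_of_real H) X Y)"
proof (rule eq_matI)
  let ?H = "map_mat complex_of_real H"
  have H': "?H \<in> carrier_mat n n" and X': "twist X \<in> carrier_mat n k" and Y': "twist Y \<in> carrier_mat n m"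
    using H X Y by auto
  fix i j assume "i < dim_row (map_mat cnj (gram ?H X Y))" "j < dim_col (map_mat cnj (gram ?H X Y))"
  hence i: "i < k" and j: "j < m" using X Y by auto
  show "gram ?H (twist X) (twist Y) $$ (i, j) = map_mat cnj (gram ?H X Y) $$ (i, j)"
  proof -
    have "gram ?H (twist X) (twist Y) $$ (i, j) = sesq_form cnj ?H (col (twist X) i) (col (twist Y) j)"
     by (rule gram_index[OF H' X' Y' i j])
    also have "\<dots> = sesq_form cnj ?H (\<i> \<cdot>\<^sub>v map_vec cnj (col X i)) (\<i> \<cdot>\<^sub>v map_vec cnj (col Y j))"
     using X Y i j by (simp add: col_twist)
    also have "\<dots> = cnj (sesq_form cnj ?H (col X i) (col Y j))"
      using X Y i j by (intro sesq_form_twist_both[OF H]) auto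
    also have "\<dots> = cnj (gram ?H X Y $$ (i, j))"
      unfolding gram_index[OF H' X Y i j] ..
    also have "\<dots> = map_mat cnj (gram ?H X Y) $$ (i, j)"
     using X Y i j by simp
    finally show ?thesis .
  qed
qed (use X Y in \<open>simp_all add: twist_def\<close>)

lemma gram_chain_mat:
  assumes H: "H \<in> carrier_mat n n" and A: "A \<in> carrier_mat n n"
    and x: "x \<in> carrier_vec n" and y: "y \<in> carrier_vec n" and i: "i < k" and j: "j < m"
  shows "gram H (chain_mat n A l k x) (chain_mat n A l' m y) $$ (i, j)
    = sesq_form cnj H ((shift A l ^^ (k - 1 - i)) x) ((shift A l' ^^ (m - 1 - j)) y)"
  unfolding gram_index[OF H chain_mat_carrier chain_mat_carrier i j]
  by (simp add: col_chain_mat[OF A x i] col_chain_mat[OF A y j])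

lemma gram_chain_mat_twist:
  fixes H :: "real mat"
  assumes H: "H \<in> carrier_mat n n" and A: "A \<in> carrier_mat n n"
    and x: "x \<in> carrier_vec n" and y: "y \<in> carrier_vec n" and i: "i < k" and j: "j < m"
  shows "gram (map_mat complex_of_real H) (chain_mat n A l k x) (twist (chain_mat n A l' m y)) $$ (i, j)
    = \<i> * cnj (sesq_form (\<lambda>x. x) (map_mat complex_of_real H)
        ((shift A l ^^ (k - 1 - i)) x) ((shift A l' ^^ (m - 1 - j)) y))"
proof -
  have H': "map_mat complex_of_real H \<in> carrier_mat n n" using H by simp
  have t: "twist (chain_mat n A l' m y) \<in> carrier_mat n m" by simp
  have c: "col (twist (chain_mat n A l' m y)) j
      = \<i> \<cdot>\<^sub>v map_vec cnj ((shift A l' ^^ (m - 1 - j)) y)"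
    using j col_chain_mat[OF A y j] by (simp add: col_twist)
  show ?thesis
    unfolding gram_index[OF H' chain_mat_carrier t i j] c col_chain_mat[OF A x i]
    by (rule sesq_form_twist_right[OF H shift_carrier[OF A x] shift_carrier[OF A y]])
qed

lemma shift_power_nilpotent:
  assumes A: "A \<in> carrier_mat n n" and "(shift A l ^^ m) y = 0\<^sub>v n"
  shows "(shift A l ^^ m) ((shift A l ^^ s) y) = 0\<^sub>v n"
proof -
  have "(shift A l ^^ (m + s)) y = 0\<^sub>v n" by (rule shift_beyond[OF A assms(2)]) simp
  thus ?thesis by (simp add: funpow_add)
qed

lemma gram_chain_mat_orthogonal:
  assumes C: "selfadjoint_pair cnj n H A" and ne: "cnj l \<noteq> l'"
    and x: "x \<in> carrier_vec n" and y: "y \<in> carrier_vec n"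
    and nx: "(shift A l ^^ k) x = 0\<^sub>v n" and ny: "(shift A l' ^^ m) y = 0\<^sub>v n"
  shows "gram H (chain_mat n A l k x) (chain_mat n A l' m y) = 0\<^sub>m k m"
proof (rule eq_matI)
  note A = selfadjoint_pair.A[OF C] and H = selfadjoint_pair.H[OF C]
  fix i j assume "i < dim_row (0\<^sub>m k m :: complex mat)" "j < dim_col (0\<^sub>m k m :: complex mat)"
  hence ij: "i < k" "j < m" by auto
  show "gram H (chain_mat n A l k x) (chain_mat n A l' m y) $$ (i, j) = 0\<^sub>m k m $$ (i, j)"
    unfolding gram_chain_mat[OF H A x y ij] index_zero_mat(1)[OF ij]
    by (rule selfadjoint_pair.generalized_eigenvectors_orthogonal[OF C ne shift_carrier[OF A x]
          shift_carrier[OF A y] shift_power_nilpotent[OF A nx] shift_power_nilpotent[OF A ny]])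
qed simp_all

lemma gram_chain_mat_twist_orthogonal:
  fixes H :: "real mat"
  defines "HC \<equiv> map_mat complex_of_real H"
  assumes H: "H \<in> carrier_mat n n" and B: "selfadjoint_pair (\<lambda>x. x) n HC A" and ne: "l \<noteq> l'"
    and x: "x \<in> carrier_vec n" and y: "y \<in> carrier_vec n"
    and nx: "(shift A l ^^ k) x = 0\<^sub>v n" and ny: "(shift A l' ^^ m) y = 0\<^sub>v n"
  shows "gram HC (chain_mat n A l k x) (twist (chain_mat n A l' m y)) = 0\<^sub>m k m"
proof (rule eq_matI)
  note A = selfadjoint_pair.A[OF B]
  fix i j assume "i < dim_row (0\<^sub>m k m :: complex mat)" "j < dim_col (0\<^sub>m k m :: complex mat)"
  hence ij: "i < k" "j < m" by auto
  have "sesq_form (\<lambda>x. x) HC ((shift A l ^^ (k - 1 - i)) x) ((shift A l' ^^ (m - 1 - j)) y) = 0"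
    by (rule selfadjoint_pair.generalized_eigenvectors_orthogonal[OF B ne shift_carrier[OF A x]
          shift_carrier[OF A y] shift_power_nilpotent[OF A nx] shift_power_nilpotent[OF A ny]])
  thus "gram HC (chain_mat n A l k x) (twist (chain_mat n A l' m y)) $$ (i, j) = 0\<^sub>m k m $$ (i, j)"
    unfolding HC_def gram_chain_mat_twist[OF H A x y ij] index_zero_mat(1)[OF ij] by simp
qed simp_all

section \<open>The canonical form\<close>

text \<open>
  Names for the blocks in the order of \<open>paired_jordan_blocks\<close>; \<open>True\<close> marks the second block of a pair.
\<close>
definition block_keys :: "nat \<Rightarrow> nat \<Rightarrow> (nat \<times> bool) list" where
  "block_keys \<alpha> \<beta> = map (\<lambda>k. (k, False)) [1..<Suc \<alpha>] @
     concat (map (\<lambda>k. [(k, False), (k, True)]) [Suc \<alpha>..<Suc \<beta>])"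

lemma paired_jordan_blocks_keys:
  "paired_jordan_blocks \<alpha> \<beta> p lam
    = map (\<lambda>(k, t). (p k, if t then cnj (lam k) else lam k)) (block_keys \<alpha> \<beta>)"
  by (simp add: paired_jordan_blocks_def block_keys_def map_concat comp_def)

text \<open>
  The representative of \<open>{l, cnj l}\<close> in the closed upper half plane.
\<close>
definition upper_eigenvalue :: "complex \<Rightarrow> complex" where
  "upper_eigenvalue l = (if Im l < 0 then cnj l else l)"

lemma upper_eigenvalue_real: "l \<in> \<real> \<Longrightarrow> upper_eigenvalue l = l"
  by (auto simp: upper_eigenvalue_def complex_is_Real_iff)

lemma Im_upper_eigenvalue: "l \<notin> \<real> \<Longrightarrow> 0 < Im (upper_eigenvalue l)"
  by (auto simp: upper_eigenvalue_def complex_is_Real_iff)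

text \<open>
  The generators are indexed by \<open>k\<close> instead of by the position in the list of blocks, and from each
  conjugate pair only the block with the upper eigenvalue is kept.
\<close>
lemma canonical_chain_generators:
  fixes A H :: "real mat" and lam :: "nat \<Rightarrow> complex"
  defines "AC \<equiv> map_mat complex_of_real A" and "HC \<equiv> map_mat complex_of_real H"
  assumes A: "A \<in> carrier_mat n n" and H: "H \<in> carrier_mat n n" and inv: "invertible_mat H"
    and sym: "H = transpose_mat H" and sa: "transpose_mat A * H = H * A"
    and le: "\<alpha> \<le> \<beta>"
    and real_ev: "\<And>k. k \<in> {1..\<alpha>} \<Longrightarrow> lam k \<in> \<real>"
    and nonreal_ev: "\<And>k. k \<in> {\<alpha>+1..\<beta>} \<Longrightarrow> lam k \<notin> \<real>"
    and jnf: "jordan_nf AC (paired_jordan_blocks \<alpha> \<beta> p lam)"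
  obtains u \<epsilon> where
    "\<And>k. k \<in> {1..\<beta>} \<Longrightarrow> u k \<in> carrier_vec n"
    "\<And>k. k \<in> {1..\<beta>} \<Longrightarrow> (shift AC (upper_eigenvalue (lam k)) ^^ p k) (u k) = 0\<^sub>v n"
    "\<And>k. k \<in> {1..\<alpha>} \<Longrightarrow> \<epsilon> k \<in> {1, -1}"
    "\<And>k l t. k \<in> {1..\<alpha>} \<Longrightarrow> l \<in> {1..\<alpha>} \<Longrightarrow> lam l = lam k \<Longrightarrow>
       sesq_form cnj HC (u k) ((shift AC (lam k) ^^ t) (u l))
         = (if k = l \<and> t = p k - 1 then \<epsilon> k else 0)"
    "\<And>k l t. k \<in> {\<alpha>+1..\<beta>} \<Longrightarrow> l \<in> {\<alpha>+1..\<beta>} \<Longrightarrow>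
       upper_eigenvalue (lam l) = upper_eigenvalue (lam k) \<Longrightarrow>
       sesq_form (\<lambda>x. x) HC (u k) ((shift AC (upper_eigenvalue (lam k)) ^^ t) (u l))
         = (if k = l \<and> t = p k - 1 then \<i> else 0)"
proof -
  define bs where "bs = paired_jordan_blocks \<alpha> \<beta> p lam"
  define key where "key k = (k, Im (lam k) < 0)" for k
  have keys: "key k \<in> set (block_keys \<alpha> \<beta>)" if "k \<in> {1..\<beta>}" for k
  proof (cases "k \<le> \<alpha>")
    case True
    with that real_ev[of k] show ?thesis
      by (auto simp: block_keys_def key_def complex_is_Real_iff)
  qed (use that in \<open>auto simp: block_keys_def key_def\<close>)
  have "\<forall>k\<in>{1..\<beta>}. \<exists>r. r < length (block_keys \<alpha> \<beta>) \<and> block_keys \<alpha> \<beta> ! r = key k"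
    using keys by (simp add: in_set_conv_nth)
  from bchoice[OF this] obtain pos where
    "\<forall>k\<in>{1..\<beta>}. pos k < length (block_keys \<alpha> \<beta>) \<and> block_keys \<alpha> \<beta> ! pos k = key k" ..
  hence pos: "pos k < length (block_keys \<alpha> \<beta>) \<and> block_keys \<alpha> \<beta> ! pos k = key k"
    if "k \<in> {1..\<beta>}" for k using that by (rule bspec)
  have len: "length bs = length (block_keys \<alpha> \<beta>)" by (simp add: bs_def paired_jordan_blocks_keys)
  have pos_less: "pos k < length bs" and bs_pos: "bs ! pos k = (p k, upper_eigenvalue (lam k))"
    if "k \<in> {1..\<beta>}" for k
    using pos[OF that] by (simp_all add: len)
      (simp add: bs_def paired_jordan_blocks_keys key_def upper_eigenvalue_def)
  have inj: "pos k = pos l \<longleftrightarrow> k = l" if "k \<in> {1..\<beta>}" "l \<in> {1..\<beta>}" for k l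
  proof
    assume "pos k = pos l"
    hence "key k = key l" using pos[OF that(1)] pos[OF that(2)] by metis
    thus "k = l" by (simp add: key_def)
  qed simp
  show thesis
  proof (rule canonical_jordan_chains_real[OF A H inv sym sa jnf[unfolded AC_def],
        folded AC_def HC_def bs_def])
    fix y e
    assume
      y: "\<And>r. r < length bs \<Longrightarrow> y r \<in> carrier_vec n"
      and ny: "\<And>r. r < length bs \<Longrightarrow> (shift AC (snd (bs ! r)) ^^ fst (bs ! r)) (y r) = 0\<^sub>v n"
      and e: "\<And>r. r < length bs \<Longrightarrow> snd (bs ! r) \<in> \<real> \<Longrightarrow> e r \<in> {1, -1}"
      and g1: "\<And>r s t. r < length bs \<Longrightarrow> s < length bs \<Longrightarrow> snd (bs ! s) = snd (bs ! r) \<Longrightarrow> snd (bs ! r) \<in> \<real> \<Longrightarrow>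
         sesq_form cnj HC (y r) ((shift AC (snd (bs ! r)) ^^ t) (y s))
           = (if r = s \<and> t = fst (bs ! r) - 1 then e r else 0)"
      and g2: "\<And>r s t. r < length bs \<Longrightarrow> s < length bs \<Longrightarrow> snd (bs ! s) = snd (bs ! r) \<Longrightarrow> snd (bs ! r) \<notin> \<real> \<Longrightarrow>
         sesq_form (\<lambda>x. x) HC (y r) ((shift AC (snd (bs ! r)) ^^ t) (y s))
           = (if r = s \<and> t = fst (bs ! r) - 1 then \<i> else 0)"
    show thesis
    proof (rule that[of "\<lambda>k. y (pos k)" "\<lambda>k. e (pos k)"])
      show "y (pos k) \<in> carrier_vec n"
        and "(shift AC (upper_eigenvalue (lam k)) ^^ p k) (y (pos k)) = 0\<^sub>v n"
        if "k \<in> {1..\<beta>}" for k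
        using y[OF pos_less[OF that]] ny[OF pos_less[OF that]] bs_pos[OF that] by simp_all
      have small: "k \<in> {1..\<beta>}" "upper_eigenvalue (lam k) = lam k" "lam k \<in> \<real>" if "k \<in> {1..\<alpha>}" for k
        using that le real_ev[OF that] upper_eigenvalue_real by auto
      have large: "k \<in> {1..\<beta>}" "upper_eigenvalue (lam k) \<notin> \<real>" if "k \<in> {\<alpha>+1..\<beta>}" for k
        using that Im_upper_eigenvalue[OF nonreal_ev[OF that]] by (auto simp: complex_is_Real_iff)
      show "e (pos k) \<in> {1, -1}" if "k \<in> {1..\<alpha>}" for k
        using e[OF pos_less[OF small(1)[OF that]]] bs_pos[OF small(1)[OF that]] small[OF that] by simp
      show "sesq_form cnj HC (y (pos k)) ((shift AC (lam k) ^^ t) (y (pos l)))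
           = (if k = l \<and> t = p k - 1 then e (pos k) else 0)"
        if "k \<in> {1..\<alpha>}" "l \<in> {1..\<alpha>}" "lam l = lam k" for k l t
        using g1[OF pos_less pos_less, of k l t] bs_pos[of k] bs_pos[of l] inj[of k l]
          small[OF that(1)] small[OF that(2)] that(3) by simp
      show "sesq_form (\<lambda>x. x) HC (y (pos k)) ((shift AC (upper_eigenvalue (lam k)) ^^ t) (y (pos l)))
           = (if k = l \<and> t = p k - 1 then \<i> else 0)"
        if "k \<in> {\<alpha>+1..\<beta>}" "l \<in> {\<alpha>+1..\<beta>}"
          "upper_eigenvalue (lam l) = upper_eigenvalue (lam k)" for k l t
        using g2[OF pos_less pos_less, of k l t] bs_pos[of k] bs_pos[of l] inj[of k l]
          large[OF that(1)] large[OF that(2)] that(3) by simp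
    qed
  qed
qed

lemma map_if_le_upt:
  assumes "\<alpha> \<le> \<beta>"
  shows "map (\<lambda>k. if k \<le> \<alpha> then f k else g k) [1..<Suc \<beta>]
    = map f [1..<Suc \<alpha>] @ map g [Suc \<alpha>..<Suc \<beta>]"
proof -
  have split: "[1..<Suc \<beta>] = [1..<Suc \<alpha>] @ [Suc \<alpha>..<Suc \<beta>]"
    using assms upt_add_eq_append[of 1 "Suc \<alpha>" "\<beta> - \<alpha>"] by simp
  have parts: "map (\<lambda>k. if k \<le> \<alpha> then f k else g k) [1..<Suc \<alpha>] = map f [1..<Suc \<alpha>]"
    "map (\<lambda>k. if k \<le> \<alpha> then f k else g k) [Suc \<alpha>..<Suc \<beta>] = map g [Suc \<alpha>..<Suc \<beta>]"
    by (intro map_cong refl; auto)+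
  show ?thesis unfolding split map_append parts ..
qed

lemma sip_block_sum_upt:
  assumes "\<alpha> \<le> \<beta>"
  shows "sip_block_sum \<alpha> \<beta> p \<epsilon> = diag_block_mat
    (map (\<lambda>k. if k \<le> \<alpha> then \<epsilon> k \<cdot>\<^sub>m sip_mat (p k) else sip_mat (2 * p k)) [1..<Suc \<beta>])"
  unfolding sip_block_sum_def map_if_le_upt[OF assms] ..

lemma jordan_matrix_paired_jordan_blocks:
  assumes "\<alpha> \<le> \<beta>"
  shows "jordan_matrix (paired_jordan_blocks \<alpha> \<beta> p lam) = diag_block_mat
    (map (\<lambda>k. if k \<le> \<alpha> then jordan_block (p k) (lam k)
       else diag_block_mat [jordan_block (p k) (lam k), jordan_block (p k) (cnj (lam k))]) [1..<Suc \<beta>])"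
proof -
  let ?f = "\<lambda>k. [(p k, lam k)]" and ?g = "\<lambda>k. [(p k, lam k), (p k, cnj (lam k))]"
  have "paired_jordan_blocks \<alpha> \<beta> p lam
      = concat (map (\<lambda>k. if k \<le> \<alpha> then ?f k else ?g k) [1..<Suc \<beta>])"
    unfolding map_if_le_upt[OF assms] paired_jordan_blocks_def concat_append
    by (simp only: concat_map_singleton)
  also have "jordan_matrix \<dots>
      = diag_block_mat (map (\<lambda>k. jordan_matrix (if k \<le> \<alpha> then ?f k else ?g k)) [1..<Suc \<beta>])"
    by (simp only: jordan_matrix_concat_diag_block_mat map_map comp_def)
  also have "(\<lambda>k. jordan_matrix (if k \<le> \<alpha> then ?f k else ?g k))
      = (\<lambda>k. if k \<le> \<alpha> then jordan_block (p k) (lam k)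
       else diag_block_mat [jordan_block (p k) (lam k), jordan_block (p k) (cnj (lam k))])"
    by (auto simp: jordan_matrix_def fun_eq_iff)
  finally show ?thesis .
qed

theorem theorem3p1:
  fixes A H :: "real mat"
    and n \<alpha> \<beta> :: nat
    and p :: "nat \<Rightarrow> nat"
    and lam :: "nat \<Rightarrow> complex"
  assumes A: "A \<in> carrier_mat n n"
    and H: "H \<in> carrier_mat n n"
    and H_inv: "invertible_mat H"
    and H_herm: "H = transpose_mat H"
    and selfadj: "H_selfadjoint H A"
    and le: "\<alpha> \<le> \<beta>"
    and real_ev: "\<And>k. k \<in> {1..\<alpha>} \<Longrightarrow> lam k \<in> \<real>"
    and nonreal_ev: "\<And>k. k \<in> {\<alpha>+1..\<beta>} \<Longrightarrow> lam k \<notin> \<real>"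
    and jnf: "jordan_nf (map_mat complex_of_real A) (paired_jordan_blocks \<alpha> \<beta> p lam)"
  shows "\<exists>\<epsilon> :: nat \<Rightarrow> complex. \<exists>N Ninv :: complex mat.
           (\<forall>k\<in>{1..\<alpha>}. \<epsilon> k \<in> {1, -1}) \<and>
           N \<in> carrier_mat n n \<and> Ninv \<in> carrier_mat n n \<and>
           inverts_mat N Ninv \<and> inverts_mat Ninv N \<and>
           Ninv * map_mat complex_of_real A * N = jordan_matrix (paired_jordan_blocks \<alpha> \<beta> p lam) \<and>
           mat_adjoint N * map_mat complex_of_real H * N = sip_block_sum \<alpha> \<beta> p \<epsilon> \<and>
           i_conjugate_symmetric n \<alpha> \<beta> p N"
proof -
  define AC where "AC = map_mat complex_of_real A"
  define HC where "HC = map_mat complex_of_real H"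
  define bs where "bs = paired_jordan_blocks \<alpha> \<beta> p lam"
  define \<mu> where "\<mu> k = upper_eigenvalue (lam k)" for k
  from selfadj obtain Hi where Hi: "inverts_mat H Hi" and AHi: "A = Hi * mat_adjoint A * H"
    unfolding H_selfadjoint_def by blast
  have adj: "mat_adjoint A = A\<^sup>T" unfolding mat_adjoint_eq by (intro eq_matI) auto
  have sa: "A\<^sup>T * H = H * A"
  proof -
    have Hic: "Hi \<in> carrier_mat n n" "H * Hi = 1\<^sub>m n"
      using Hi AHi A H unfolding inverts_mat_def
      by (metis carrier_matD carrier_matI index_mult_mat(2,3) index_one_mat(3))+
    have "H * A = H * (Hi * (A\<^sup>T * H))"
      unfolding adj[symmetric] by (subst AHi) (use A H Hic in \<open>simp add: adj assoc_mult_mat[of _ n n _ n _ n]\<close>)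
    also have "\<dots> = (H * Hi) * (A\<^sup>T * H)"
      using A H Hic by (intro assoc_mult_mat[symmetric, of _ n n _ n _ n]) auto
    finally show ?thesis using A H Hic by simp
  qed
  have C: "selfadjoint_pair cnj n HC AC"
    unfolding AC_def HC_def by (rule selfadjoint_pair_of_real[OF field_hom_cnj _ _ A H H_herm sa]) auto
  have B: "selfadjoint_pair (\<lambda>x. x) n HC AC"
    unfolding AC_def HC_def by (rule selfadjoint_pair_of_real[OF field_hom_ident _ _ A H H_herm sa]) auto
  note AC = selfadjoint_pair.A[OF C] and HC = selfadjoint_pair.H[OF C]
  show ?thesis
  proof (rule canonical_chain_generators[OF A H H_inv H_herm sa le real_ev nonreal_ev jnf,
        folded AC_def HC_def \<mu>_def])
    fix u \<epsilon>
    assume u: "\<And>k. k \<in> {1..\<beta>} \<Longrightarrow> u k \<in> carrier_vec n"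
      and nu: "\<And>k. k \<in> {1..\<beta>} \<Longrightarrow> (shift AC (\<mu> k) ^^ p k) (u k) = 0\<^sub>v n"
      and eps: "\<And>k. k \<in> {1..\<alpha>} \<Longrightarrow> \<epsilon> k \<in> {1, -1}"
      and g1: "\<And>k l t. k \<in> {1..\<alpha>} \<Longrightarrow> l \<in> {1..\<alpha>} \<Longrightarrow> lam l = lam k \<Longrightarrow>
         sesq_form cnj HC (u k) ((shift AC (lam k) ^^ t) (u l))
           = (if k = l \<and> t = p k - 1 then \<epsilon> k else 0)"
      and g2: "\<And>k l t. k \<in> {\<alpha>+1..\<beta>} \<Longrightarrow> l \<in> {\<alpha>+1..\<beta>} \<Longrightarrow> \<mu> l = \<mu> k \<Longrightarrow>
         sesq_form (\<lambda>x. x) HC (u k) ((shift AC (\<mu> k) ^^ t) (u l))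
           = (if k = l \<and> t = p k - 1 then \<i> else 0)"
    have small: "k \<in> {1..\<beta>}" "\<mu> k = lam k" "lam k \<in> \<real>" "cnj (lam k) = lam k" if "k \<in> {1..\<alpha>}" for k
      using that le real_ev[OF that] upper_eigenvalue_real by (auto simp: \<mu>_def Reals_cnj_iff)
    have large: "k \<in> {1..\<beta>}" "0 < Im (\<mu> k)" if "k \<in> {\<alpha>+1..\<beta>}" for k
      using that Im_upper_eigenvalue[OF nonreal_ev[OF that]] by (auto simp: \<mu>_def)

    define X where "X k = chain_mat n AC (\<mu> k) (p k) (u k)" for k
    have X: "X k \<in> carrier_mat n (p k)" for k by (simp add: X_def)
    have AX: "AC * X k = X k * jordan_block (p k) (\<mu> k)" if "k \<in> {1..\<beta>}" for k
      unfolding X_def by (rule mult_chain_mat[OF AC u[OF that] nu[OF that]])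
    \<comment> \<open>The two halves of the \<open>k\<close>-th nonreal part of \<open>N\<close>; they are interchanged if \<open>lam k\<close> lies in the lower
      half plane.\<close>
    define D where "D k t = (if t = (Im (lam k) < 0) then X k else twist (X k))" for k t
    have D: "D k t \<in> carrier_mat n (p k)" for k t using X by (simp add: D_def)
    have twist_D: "twist (D k t) = D k (\<not> t)" for k t by (auto simp: D_def)
    have AD: "AC * D k t = D k t * jordan_block (p k) (if t then cnj (lam k) else lam k)"
      if "k \<in> {1..\<beta>}" for k t
    proof -
      have tw: "AC * twist (X k) = twist (X k) * jordan_block (p k) (cnj (\<mu> k))"
        using mult_twist[OF A X] AX[OF that] by (simp add: AC_def)
      show ?thesis
        using tw AX[OF that] by (auto simp: D_def \<mu>_def upper_eigenvalue_def)
    qed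

    have gram_real: "gram HC (X k) (X l) = (if k = l then \<epsilon> k \<cdot>\<^sub>m sip_mat (p k) else 0\<^sub>m (p k) (p l))"
      if k: "k \<in> {1..\<alpha>}" and l: "l \<in> {1..\<alpha>}" for k l
    proof (cases "lam l = lam k")
      case False
      hence "cnj (\<mu> k) \<noteq> \<mu> l" using small[OF k] small[OF l] by simp
      hence "gram HC (X k) (X l) = 0\<^sub>m (p k) (p l)"
        unfolding X_def using u nu small(1) k l by (intro gram_chain_mat_orthogonal[OF C]) auto
      thus ?thesis using False by auto
    next
      case True
      show ?thesis
      proof (rule eq_matI)
        fix i j assume "i < dim_row (if k = l then \<epsilon> k \<cdot>\<^sub>m sip_mat (p k) else 0\<^sub>m (p k) (p l))"
          "j < dim_col (if k = l then \<epsilon> k \<cdot>\<^sub>m sip_mat (p k) else 0\<^sub>m (p k) (p l))"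
        hence i: "i < p k" and j: "j < p l" by (auto simp: sip_mat_def split: if_splits)
        note uk = u[OF small(1)[OF k]] and ul = u[OF small(1)[OF l]]
        have "gram HC (X k) (X l) $$ (i, j) = sesq_form cnj HC
            ((shift AC (lam k) ^^ (p k - 1 - i)) (u k)) ((shift AC (lam k) ^^ (p l - 1 - j)) (u l))"
          unfolding X_def small(2)[OF k] small(2)[OF l] True by (rule gram_chain_mat[OF HC AC uk ul i j])
        also have "\<dots> = sesq_form cnj HC (u k)
            ((shift AC (lam k) ^^ ((p k - 1 - i) + (p l - 1 - j))) (u l))"
          using selfadjoint_pair.shift_selfadjoint[OF C small(4)[OF k] uk ul]
          by (simp add: selfadjoint_pair.moment_def[OF C])
        also have "\<dots> = (if k = l \<and> (p k - 1 - i) + (p l - 1 - j) = p k - 1 then \<epsilon> k else 0)"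
          by (rule g1[OF k l True])
        also have "\<dots> = (if k = l then \<epsilon> k \<cdot>\<^sub>m sip_mat (p k) else 0\<^sub>m (p k) (p l)) $$ (i, j)"
          using i j by (auto simp: sip_mat_def)
        finally show "gram HC (X k) (X l) $$ (i, j)
          = (if k = l then \<epsilon> k \<cdot>\<^sub>m sip_mat (p k) else 0\<^sub>m (p k) (p l)) $$ (i, j)" .
      qed (use carrier_matD[OF X] in \<open>auto simp: sip_mat_def\<close>)
    qed

    have gram_twist: "gram HC (X k) (twist (X l)) = (if k = l then sip_mat (p k) else 0\<^sub>m (p k) (p l))"
      if k: "k \<in> {\<alpha>+1..\<beta>}" and l: "l \<in> {\<alpha>+1..\<beta>}" for k l
    proof (cases "\<mu> l = \<mu> k")
      case False
      hence "gram HC (X k) (twist (X l)) = 0\<^sub>m (p k) (p l)"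
        unfolding X_def HC_def using u nu large(1) k l
        by (intro gram_chain_mat_twist_orthogonal[OF H B[unfolded HC_def]]) auto
      thus ?thesis using False by auto
    next
      case True
      show ?thesis
      proof (rule eq_matI)
        fix i j assume "i < dim_row (if k = l then sip_mat (p k) else 0\<^sub>m (p k) (p l) :: complex mat)"
          "j < dim_col (if k = l then sip_mat (p k) else 0\<^sub>m (p k) (p l) :: complex mat)"
        hence i: "i < p k" and j: "j < p l" by (auto simp: sip_mat_def split: if_splits)
        note uk = u[OF large(1)[OF k]] and ul = u[OF large(1)[OF l]]
        have s: "sesq_form (\<lambda>x. x) HC
            ((shift AC (\<mu> k) ^^ (p k - 1 - i)) (u k)) ((shift AC (\<mu> k) ^^ (p l - 1 - j)) (u l))
          = sesq_form (\<lambda>x. x) HC (u k) ((shift AC (\<mu> k) ^^ ((p k - 1 - i) + (p l - 1 - j))) (u l))"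
          using selfadjoint_pair.shift_selfadjoint[OF B refl uk ul]
          unfolding selfadjoint_pair.moment_def[OF B] .
        have "gram HC (X k) (twist (X l)) $$ (i, j) = \<i> * cnj (sesq_form (\<lambda>x. x) HC
            ((shift AC (\<mu> k) ^^ (p k - 1 - i)) (u k)) ((shift AC (\<mu> k) ^^ (p l - 1 - j)) (u l)))"
          unfolding X_def True HC_def by (rule gram_chain_mat_twist[OF H AC uk ul i j])
        also have "\<dots> = \<i> * cnj (if k = l \<and> (p k - 1 - i) + (p l - 1 - j) = p k - 1 then \<i> else 0)"
          unfolding s g2[OF k l True] ..
        also have "\<dots> = (if k = l then sip_mat (p k) else 0\<^sub>m (p k) (p l)) $$ (i, j)"
          using i j by (auto simp: sip_mat_def)
        finally show "gram HC (X k) (twist (X l)) $$ (i, j)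
          = (if k = l then sip_mat (p k) else 0\<^sub>m (p k) (p l)) $$ (i, j)" .
      qed (use carrier_matD[OF X] in \<open>auto simp: sip_mat_def\<close>)
    qed

    have gram_nonreal: "gram HC (D k s) (D l t)
        = (if k = l \<and> s \<noteq> t then sip_mat (p k) else 0\<^sub>m (p k) (p l))"
      if k: "k \<in> {\<alpha>+1..\<beta>}" and l: "l \<in> {\<alpha>+1..\<beta>}" for k l s t
    proof -
      have tX: "twist (X l) \<in> carrier_mat n (p l)" using X by simp
      have "cnj (\<mu> k) \<noteq> \<mu> l" using large(2)[OF k] large(2)[OF l] by (auto simp: complex_eq_iff)
      hence XX: "gram HC (X k) (X l) = 0\<^sub>m (p k) (p l)"
        unfolding X_def using u nu large(1) k l by (intro gram_chain_mat_orthogonal[OF C]) auto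
      have tt: "gram HC (twist (X k)) (twist (X l)) = 0\<^sub>m (p k) (p l)"
        unfolding HC_def gram_twist_twist[OF H X X] using XX by (intro eq_matI) (auto simp: HC_def)
      have tX': "gram HC (twist (X k)) (X l) = map_mat cnj (gram HC (X k) (twist (X l)))"
        using gram_twist_twist[OF H X tX] by (simp add: HC_def)
      have "gram HC (twist (X k)) (X l) = (if k = l then sip_mat (p k) else 0\<^sub>m (p k) (p l))"
        unfolding tX' gram_twist[OF k l] by (intro eq_matI) (auto simp: sip_mat_def)
      thus ?thesis
        using XX tt gram_twist[OF k l] by (auto simp: D_def)
    qed

    have gram_mixed: "gram HC (X k) (D l t) = 0\<^sub>m (p k) (p l)"
      if k: "k \<in> {1..\<alpha>}" and l: "l \<in> {\<alpha>+1..\<beta>}" for k l t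
    proof -
      have ne: "\<mu> k \<noteq> \<mu> l" "cnj (\<mu> k) \<noteq> \<mu> l"
        using small[OF k] large[OF l] by (auto simp: complex_is_Real_iff)
      have "gram HC (X k) (X l) = 0\<^sub>m (p k) (p l)"
        unfolding X_def using u nu small(1) large(1) k l ne by (intro gram_chain_mat_orthogonal[OF C]) auto
      moreover have "gram HC (X k) (twist (X l)) = 0\<^sub>m (p k) (p l)"
        unfolding X_def HC_def using u nu small(1) large(1) k l ne
        by (intro gram_chain_mat_twist_orthogonal[OF H B[unfolded HC_def]]) auto
      ultimately show ?thesis by (simp add: D_def)
    qed

    define Ns where "Ns k = (if k \<le> \<alpha> then [X k] else [D k False, D k True])" for k
    define Nb where "Nb k = hconcat_mat n (Ns k)" for k
    define d where "d k = (if k \<le> \<alpha> then p k else 2 * p k)" for k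
    define N where "N = hconcat_mat n (map Nb [1..<Suc \<beta>])"
    define P where "P = sip_block_sum \<alpha> \<beta> p \<epsilon>"
    have Nb: "Nb k \<in> carrier_mat n (d k)" for k
      using X[THEN carrier_matD(2)] D[THEN carrier_matD(2)]
      by (auto simp: Nb_def Ns_def d_def intro!: carrier_matI)
    have Nb_real: "Nb k = X k" if "k \<le> \<alpha>" for k using that by (simp add: Nb_def Ns_def hconcat_mat_singleton[OF X])
    have rng: "k \<in> set [1..<Suc \<beta>] \<longleftrightarrow> k \<in> {1..\<alpha>} \<or> k \<in> {\<alpha>+1..\<beta>}" for k using le by auto

    have ANb: "AC * N = N * jordan_matrix bs"
      unfolding bs_def jordan_matrix_paired_jordan_blocks[OF le] N_def
    proof (rule mult_hconcat_mat[OF AC], unfold list_all2_map1 list_all2_map2, rule list.rel_refl_strong)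
      fix k assume "k \<in> set [1..<Suc \<beta>]"
      hence kb: "k \<in> {1..\<beta>}" by auto
      show "\<exists>m. Nb k \<in> carrier_mat n m \<and> (if k \<le> \<alpha> then jordan_block (p k) (lam k)
          else diag_block_mat [jordan_block (p k) (lam k), jordan_block (p k) (cnj (lam k))]) \<in> carrier_mat m m \<and>
        AC * Nb k = Nb k * (if k \<le> \<alpha> then jordan_block (p k) (lam k)
          else diag_block_mat [jordan_block (p k) (lam k), jordan_block (p k) (cnj (lam k))])"
      proof (cases "k \<le> \<alpha>")
        case True
        thus ?thesis using X[of k] AX[OF kb] small(2)[of k] kb
          by (auto simp: Nb_real intro!: exI[of _ "p k"])
      next
        case False
        have "AC * hconcat_mat n [D k False, D k True] = hconcat_mat n [D k False, D k True]
            * diag_block_mat [jordan_block (p k) (lam k), jordan_block (p k) (cnj (lam k))]"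
          by (rule mult_hconcat_mat[OF AC])
            (use D[of k] AD[OF kb, of False] AD[OF kb, of True] in \<open>auto intro!: exI[of _ "p k"]\<close>)
        moreover have "diag_block_mat [jordan_block (p k) (lam k), jordan_block (p k) (cnj (lam k))]
            \<in> carrier_mat (2 * p k) (2 * p k)"
          by (intro carrier_matI) (simp_all add: dim_diag_block_mat del: diag_block_mat.simps)
        ultimately show ?thesis using False Nb[of k]
          by (intro exI[of _ "2 * p k"]) (simp add: Nb_def Ns_def d_def del: diag_block_mat.simps)
      qed
    qed

    have n: "n = sum_list (map fst bs)"
      using jnf AC unfolding jordan_nf_def similar_mat_def similar_mat_wit_def Let_def bs_def AC_def[symmetric]
      by (metis carrier_matD(1) insert_subset jordan_matrix_dim(1))
    have J: "jordan_matrix bs \<in> carrier_mat n n" unfolding n by simp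
    have "sum_list (map d [1..<Suc \<beta>]) = n"
    proof -
      have "dim_row (jordan_matrix bs) = sum_list (map d [1..<Suc \<beta>])"
        unfolding bs_def jordan_matrix_paired_jordan_blocks[OF le] dim_diag_block_mat map_map
        by (intro arg_cong[of _ _ sum_list] map_cong refl)
          (auto simp: d_def dim_diag_block_mat simp del: diag_block_mat.simps)
      thus ?thesis using carrier_matD(1)[OF J] by metis
    qed
    moreover have "map dim_col (map Nb [1..<Suc \<beta>]) = map d [1..<Suc \<beta>]"
      using Nb[THEN carrier_matD(2)] by (simp add: comp_def del: upt_Suc)
    ultimately have "dim_col N = n" unfolding N_def hconcat_mat_dims by metis
    hence N: "N \<in> carrier_mat n n" by (intro carrier_matI) (simp_all add: N_def)

    have orth: "gram HC (Nb k) (Nb l) = 0\<^sub>m (d k) (d l)"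
      if kl: "k \<in> set [1..<Suc \<beta>]" "l \<in> set [1..<Suc \<beta>]" "k \<noteq> l" for k l
    proof -
      have rows: "dim_row M = n" if "M \<in> set (Ns k)" for M k
        using that X D[THEN carrier_matD(1)] by (auto simp: Ns_def split: if_splits)
      have right: "gram HC Y (Nb l) = 0\<^sub>m m (d l)"
        if "Y \<in> carrier_mat n m" "\<And>M. M \<in> set (Ns l) \<Longrightarrow> gram HC Y M = 0\<^sub>m m (dim_col M)" for Y m l
      proof -
        have "sum_list (map dim_col (Ns l)) = d l"
          using carrier_matD(2)[OF Nb[of l]] unfolding Nb_def hconcat_mat_dims .
        thus ?thesis unfolding Nb_def
          using gram_hconcat_zero[OF HC that(1), of "Ns l"] rows that(2) by auto
      qed
      have mix: "gram HC (Nb k) (Nb l) = 0\<^sub>m (d k) (d l)"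
        if k: "k \<in> {1..\<alpha>}" and l: "l \<in> {\<alpha>+1..\<beta>}" for k l
      proof -
        have "gram HC (X k) (Nb l) = 0\<^sub>m (p k) (d l)"
          by (rule right[OF X]) (use l gram_mixed[OF k l] D[THEN carrier_matD(2)] in \<open>auto simp: Ns_def\<close>)
        thus ?thesis using k by (simp add: Nb_real d_def)
      qed
      from kl consider "k \<in> {1..\<alpha>}" "l \<in> {1..\<alpha>}" | "k \<in> {1..\<alpha>}" "l \<in> {\<alpha>+1..\<beta>}"
        | "k \<in> {\<alpha>+1..\<beta>}" "l \<in> {1..\<alpha>}" | "k \<in> {\<alpha>+1..\<beta>}" "l \<in> {\<alpha>+1..\<beta>}"
        unfolding rng by blast
      thus ?thesis
      proof cases
        case 1
        thus ?thesis using gram_real[OF 1] kl(3) by (simp add: Nb_real d_def)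
      next
        case 2
        thus ?thesis by (rule mix)
      next
        case 3
        show ?thesis by (rule gram_zero_swap[OF C Nb Nb mix[OF 3(2,1)]])
      next
        case 4
        have "gram HC (D l t) (Nb k) = 0\<^sub>m (p l) (d k)" for t
          by (rule right[OF D]) (use 4 gram_nonreal[OF 4(2,1)] kl(3) D[THEN carrier_matD(2)] in \<open>auto simp: Ns_def\<close>)
        hence "gram HC (Nb k) (D l t) = 0\<^sub>m (d k) (p l)" for t
          by (rule gram_zero_swap[OF C D Nb])
        thus ?thesis
          by (intro right[OF Nb]) (use 4 D[THEN carrier_matD(2)] in \<open>auto simp: Ns_def\<close>)
      qed
    qed

    have diag: "gram HC (Nb k) (Nb k) = (if k \<le> \<alpha> then \<epsilon> k \<cdot>\<^sub>m sip_mat (p k) else sip_mat (2 * p k))"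
      if k: "k \<in> set [1..<Suc \<beta>]" for k
    proof (cases "k \<le> \<alpha>")
      case True
      hence "k \<in> {1..\<alpha>}" using k by auto
      thus ?thesis using gram_real[of k k] True by (simp add: Nb_real)
    next
      case False
      hence kl: "k \<in> {\<alpha>+1..\<beta>}" using k by auto
      have "gram HC (Nb k) (Nb k) = four_block_mat (0\<^sub>m (p k) (p k)) (sip_mat (p k)) (sip_mat (p k)) (0\<^sub>m (p k) (p k))"
        using False D[of k True] gram_hconcat_Cons[OF HC D[of k False], of "[D k True]"]
        by (simp add: Nb_def Ns_def gram_nonreal[OF kl kl])
      thus ?thesis using False by (simp add: sip_mat_double)
    qed

    have gram_N: "gram HC N N = P"
    proof -
      have "gram HC N N = diag_block_mat (map (\<lambda>k. gram HC (Nb k) (Nb k)) [1..<Suc \<beta>])"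
        unfolding N_def by (rule gram_hconcat_orthogonal[OF C distinct_upt, where d = d]) (rule Nb, rule orth)
      also have "map (\<lambda>k. gram HC (Nb k) (Nb k)) [1..<Suc \<beta>]
          = map (\<lambda>k. if k \<le> \<alpha> then \<epsilon> k \<cdot>\<^sub>m sip_mat (p k) else sip_mat (2 * p k)) [1..<Suc \<beta>]"
        by (intro map_cong refl diag)
      finally show ?thesis unfolding P_def sip_block_sum_upt[OF le] .
    qed

    have P: "P \<in> carrier_mat n n" unfolding gram_N[symmetric] using N by (intro carrier_matI) auto
    have PP: "P * P = 1\<^sub>m n"
    proof -
      have "P * P = 1\<^sub>m (dim_row P)"
        unfolding P_def sip_block_sum_upt[OF le]
      proof (rule diag_block_mat_involutions)
        fix M assume "M \<in> set (map (\<lambda>k. if k \<le> \<alpha> then \<epsilon> k \<cdot>\<^sub>m sip_mat (p k) else sip_mat (2 * p k)) [1..<Suc \<beta>])"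
        then obtain k where k: "k \<in> set [1..<Suc \<beta>]"
          and M: "M = (if k \<le> \<alpha> then \<epsilon> k \<cdot>\<^sub>m sip_mat (p k) else sip_mat (2 * p k))"
          unfolding set_map by (rule imageE)
        show "square_mat M \<and> M * M = 1\<^sub>m (dim_row M)"
        proof (cases "k \<le> \<alpha>")
          case True
          hence "k \<in> {1..\<alpha>}" using k by auto
          hence ee: "\<epsilon> k * \<epsilon> k = 1" using eps[of k] by auto
          have "(\<epsilon> k \<cdot>\<^sub>m sip_mat (p k)) * (\<epsilon> k \<cdot>\<^sub>m sip_mat (p k)) = (\<epsilon> k * \<epsilon> k) \<cdot>\<^sub>m (sip_mat (p k) * sip_mat (p k))"
            by (rule smult_mat_square[OF sip_mat_carrier])
          also have "\<dots> = 1\<^sub>m (p k)" unfolding ee sip_mat_square by (intro eq_matI) auto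
          finally show ?thesis using M True by (simp add: sip_mat_def)
        next
          case False
          thus ?thesis using M sip_mat_square[of "2 * p k"] by (simp add: sip_mat_def)
        qed
      qed
      thus ?thesis using P by simp
    qed

    \<comment> \<open>Invertibility of \<open>N\<close> comes from its Gram matrix \<open>P\<close>, an involution.\<close>
    define Ni where "Ni = P * (mat_adjoint N * HC)"
    have aN: "mat_adjoint N \<in> carrier_mat n n" using N by (simp add: mat_adjoint_eq)
    have Ni: "Ni \<in> carrier_mat n n" using P aN HC by (simp add: Ni_def)
    have "Ni * N = P * (mat_adjoint N * HC * N)"
      unfolding Ni_def using P aN HC N
      by (metis assoc_mult_mat mult_carrier_mat)
    also have "\<dots> = 1\<^sub>m n" unfolding gram_def[symmetric] gram_N by (rule PP)
    finally have NiN: "Ni * N = 1\<^sub>m n" .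
    hence NNi: "N * Ni = 1\<^sub>m n" using mat_mult_left_right_inverse[OF Ni N] by simp
    have "Ni * AC * N = Ni * (N * jordan_matrix bs)"
      unfolding ANb[symmetric] using Ni AC N by (intro assoc_mult_mat) auto
    also have "\<dots> = Ni * N * jordan_matrix bs" using Ni N J by (intro assoc_mult_mat[symmetric]) auto
    also have "\<dots> = jordan_matrix bs" unfolding NiN by (rule left_mult_one_mat[OF J])
    finally have NAN: "Ni * AC * N = jordan_matrix bs" .

    have "i_conjugate_symmetric n \<alpha> \<beta> p N"
      unfolding i_conjugate_symmetric_def
    proof (intro exI[of _ Nb] conjI ballI)
      show "Nb k \<in> carrier_mat n (p k)" if "k \<in> {1..\<alpha>}" for k using Nb[of k] that by (simp add: d_def)
      fix k assume k: "k \<in> {\<alpha>+1..\<beta>}"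
      show "Nb k \<in> carrier_mat n (2 * p k)" using Nb[of k] k by (simp add: d_def)
      have "Nb k = hconcat_mat n [D k False, \<i> \<cdot>\<^sub>m map_mat cnj (D k False)]"
        using k twist_D[of k False] by (simp add: Nb_def Ns_def twist_def)
      thus "\<exists>Q\<in>carrier_mat n (p k). Nb k = hconcat_mat n [Q, \<i> \<cdot>\<^sub>m map_mat cnj Q]"
        using D by blast
    qed (simp add: N_def)
    moreover have "inverts_mat N Ni" "inverts_mat Ni N"
      using NNi NiN carrier_matD(1)[OF N] carrier_matD(1)[OF Ni] unfolding inverts_mat_def by metis+
    ultimately show ?thesis
      using eps N Ni NAN gram_N unfolding AC_def HC_def bs_def P_def gram_def by blast
  qed
qed

end
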